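(* Let $(X_n)_{n\geq -1}$ be a second-order Galton--Watson process with immigration with generic offspring variables $\xi,\eta$ and generic immigration variable $\varepsilon$, such that $X_0$, $X_{-1}$ and $\varepsilon$ are regularly varying with index $\beta\in[0,\infty)$, and there exists $r\in(\max(1,\beta),\infty)$ with $\mathbb{E}(\xi^r)<\infty$ and $\mathbb{E}(\eta^r)<\infty$. Then for all $n\in\mathbb{N}$, \[ \mathbb{P}(X_n>x) \sim m_n^\beta\,\mathbb{P}(X_0>x) + m_{n-1}^\beta m_\eta^\beta\,\mathbb{P}(X_{-1}>x) + \sum_{i=1}^n m_{n-i}^\beta\,\mathbb{P}(\varepsilon>x) \] as $x\to\infty$, yielding that $X_n$ is regularly varying with index $\beta$.
   Context: A second-order Galton--Watson process with immigration $(X_n)_{n\geq -1}$ is defined by $X_n = \sum_{i=1}^{X_{n-1}} \xi_{n,i} + \sum_{j=1}^{X_{n-2}} \eta_{n,j} + \varepsilon_n$ for $n\in\mathbb{N}=\{1,2,\dots\}$, where $X_{-1}, X_0$ (initial values) and all $\xi_{n,i},\eta_{n,j},\varepsilon_n$ ($n,i,j\in\mathbb{N}$) are independent non-negative integer-valued random variables, the $\xi_{n,i}$ are identically distributed with generic copy $\xi$, the $\eta_{n,j}$ identically distributed with generic copy $\eta$, and the $\varepsilon_n$ identically distributed with generic copy $\varepsilon$. Write $m_\xi=\mathbb{E}(\xi)$, $m_\eta=\mathbb{E}(\eta)$. Set $m_0:=1$ and for $k\in\mathbb{N}$, $m_k := \frac{\lambda_+^{k+1}-\lambda_-^{k+1}}{\lambda_+-\lambda_-}$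 with $\lambda_\pm := \frac{m_\xi \pm \sqrt{m_\xi^2+4m_\eta}}{2}$. A non-negative random variable $X$ is regularly varying with index $\alpha\geq 0$ if $\lim_{x\to\infty}\mathbb{P}(X>qx)/\mathbb{P}(X>x) = q^{-\alpha}$ for all $q>0$. $f\sim g$ means $f(x)/g(x)\to 1$ as $x\to\infty$.
   Formalization: Powers are read with 0^0 = 0 (with 0^0 = 1 the formula fails for β = 0 when m_η or some m_k vanishes, e.g. ξ = 1, η = 0, n = 1), and m_k is taken as 0 for k ≥ 1 when m_ξ = m_η = 0, where the quotient defining it is 0/0. *)

theory Defs
  imports "HOL-Probability.Probability" "HOL-Library.Landau_Symbols"
begin

text \<open>Index set of the independent building blocks of a second-order
Galton--Watson process with immigration.\<close>
datatype gw_idx = IX0 | IXm1 | Ixi nat nat | Ieta nat nat | Ieps nat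

definition gw_idxs :: "gw_idx set" where
  "gw_idxs = {IX0, IXm1} \<union> {Ixi n i |n i. n \<ge> 1 \<and> i \<ge> 1}
     \<union> {Ieta n j |n j. n \<ge> 1 \<and> j \<ge> 1} \<union> {Ieps n |n. n \<ge> 1}"

definition gw_var ::
  "('a \<Rightarrow> nat) \<Rightarrow> ('a \<Rightarrow> nat) \<Rightarrow> (nat \<Rightarrow> nat \<Rightarrow> 'a \<Rightarrow> nat)
   \<Rightarrow> (nat \<Rightarrow> nat \<Rightarrow> 'a \<Rightarrow> nat) \<Rightarrow> (nat \<Rightarrow> 'a \<Rightarrow> nat) \<Rightarrow> gw_idx \<Rightarrow> 'a \<Rightarrow> nat" where
  "gw_var X0 Xm1 xi eta eps k = (case k of IX0 \<Rightarrow> X0 | IXm1 \<Rightarrow> Xm1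
     | Ixi n i \<Rightarrow> xi n i | Ieta n j \<Rightarrow> eta n j | Ieps n \<Rightarrow> eps n)"

definition regvar :: "'a measure \<Rightarrow> ('a \<Rightarrow> real) \<Rightarrow> real \<Rightarrow> bool" where
  "regvar M Y \<alpha> \<longleftrightarrow> \<alpha> \<ge> 0 \<and> (\<forall>q>0.
     ((\<lambda>x. measure M {\<omega>\<in>space M. Y \<omega> > q * x} / measure M {\<omega>\<in>space M. Y \<omega> > x})
        \<longlongrightarrow> q powr (-\<alpha>)) at_top)"

definition lam_plus :: "real \<Rightarrow> real \<Rightarrow> real" where
  "lam_plus mxi meta = (mxi + sqrt (mxi^2 + 4 * meta)) / 2"

definition lam_minus :: "real \<Rightarrow> real \<Rightarrow> real" where
  "lam_minus mxi meta = (mxi - sqrt (mxi^2 + 4 * meta)) / 2"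

definition mseq :: "real \<Rightarrow> real \<Rightarrow> nat \<Rightarrow> real" where
  "mseq mxi meta k = (if k = 0 then 1 else
     (lam_plus mxi meta ^ (k+1) - lam_minus mxi meta ^ (k+1)) /
     (lam_plus mxi meta - lam_minus mxi meta))"

end

theory Submission
  imports Defs
begin

text \<open>
  Replacing every offspring variable by its mean turns $X_n$ into a linear combination $L_n$ of the
  independent variables $X_0$, $X_{-1}$, $\varepsilon_1, \dots, \varepsilon_n$, whose tail is
  given by the principle of a single big jump. By induction on $n$,
  $P(|X_n - L_n| > \delta (x + L_n)) = o(P(L_n > x))$ for every $\delta > 0$, so that $X_n$ and $L_n$ have
  equivalent tails. Measuring the error relative to $x + L_n$ instead of $x$ is essential for
  $\beta = 0$, where $X_n$ may exceed $x$ by many orders of magnitude; comparing with $P(L_n > x)$ rather than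
  with the tails of all sources is needed since some weights $m_k$ may vanish.

  In the induction step the number $N$ of parents is independent of their centred offspring, whose partial
  sums $S_k$ satisfy $E|S_k|^r \le C k^\rho$ with $\rho = r - \min(r,2) + 1 < r$. Markov's inequality bounds
  $P(|S_N| > \delta (x + N))$ by a multiple of $E(N^\rho (x + N)^{-r})$, which is $o(P(N > x))$ because
  truncated moments of $N$ of order $p > \beta$ are $O(x^p P(N > x))$.
\<close>

subsection \<open>Regularly varying functions\<close>

text \<open>The recursion adds two offspring sums whose parent counts X_(n-1) and X_(n-2) are
  dependent, so tails cannot be added along it. Hence the pathwise comparison with L_n: deviation
  events combine by a union bound, which ignores dependence, and the only tails ever added are those
  of the independent sources of L_n. Within a single offspring sum the parent count is a function of
  earlier coordinates only. All building blocks therefore form one indexed family, which is cut into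
  disjoint blocks of coordinates. The exponent rho stems from expanding |a + b|^r around a, where
  the term linear in b has mean zero. Each new summand then costs O(k^(r - min(r,2))), and adding k
  such costs gives one more power of k. For r > 2 the exponent is not sharp, but rho < r is enough:
  it leaves room for some p with max(rho, beta) < p < r, and the resulting factor x^(p - r) supplies
  the little-o.\<close>

definition rv :: "(real \<Rightarrow> real) \<Rightarrow> real \<Rightarrow> bool" where
  "rv F \<beta> \<longleftrightarrow> (\<forall>x. F x \<ge> 0) \<and>
     (\<forall>q>0. ((\<lambda>x. F (q * x) / F x) \<longlongrightarrow> q powr (-\<beta>)) at_top)"

lemma rv_nonneg: "rv F \<beta> \<Longrightarrow> F x \<ge> 0"
  by (simp add: rv_def)

lemma rv_ratio: "rv F \<beta> \<Longrightarrow> q > 0 \<Longrightarrow> ((\<lambda>x. F (q * x) / F x) \<longlongrightarrow> q powr (-\<beta>)) at_top"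
  by (simp add: rv_def)

lemma rv_eventually_pos:
  assumes "rv F \<beta>"
  shows "eventually (\<lambda>x. F x > 0) at_top"
proof -
  \<comment> \<open>At \<open>q = 1\<close> the ratio tends to 1. Division by zero yields 0, so
    \<open>F\<close> cannot vanish for large \<open>x\<close>.\<close>
  have "eventually (\<lambda>x. F (1 * x) / F x > 0) at_top"
    using order_tendstoD(1)[OF rv_ratio[OF assms, of 1], of 0] by simp
  thus ?thesis
    by eventually_elim (use rv_nonneg[OF assms] in \<open>auto simp: less_le\<close>)
qed

lemma rv_scale_asymp:
  assumes "rv F \<beta>" "q > 0"
  shows "(\<lambda>x. F (q * x)) \<sim>[at_top] (\<lambda>x. q powr (-\<beta>) * F x)"
proof (rule asymp_equivI')
  have "((\<lambda>x. (F (q * x) / F x) / q powr (-\<beta>)) \<longlongrightarrow> q powr (-\<beta>) / q powr (-\<beta>)) at_top"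
    using assms by (intro tendsto_intros rv_ratio) auto
  thus "((\<lambda>x. F (q * x) / (q powr (-\<beta>) * F x)) \<longlongrightarrow> 1) at_top"
    using assms by (simp add: field_simps)
qed

lemma rv_scale_bigo:
  assumes "rv F \<beta>" "q > 0"
  shows "(\<lambda>x. F (q * x)) \<in> O(F)"
proof -
  have "(\<lambda>x. F (q * x)) \<in> O(\<lambda>x. q powr (-\<beta>) * F x)"
    by (rule asymp_equiv_imp_bigo[OF rv_scale_asymp[OF assms]])
  thus ?thesis using assms by simp
qed

lemma filterlim_scale_at_top: "(q::real) > 0 \<Longrightarrow> filterlim (\<lambda>x. q * x) at_top at_top"
  by (rule filterlim_tendsto_pos_mult_at_top[OF tendsto_const]) (auto simp: filterlim_ident)

lemma rv_asymp_equiv: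
  assumes F: "rv F \<beta>" and H: "H \<sim>[at_top] F" "\<And>x. H x \<ge> 0"
  shows "rv H \<beta>"
  unfolding rv_def
proof (intro conjI allI impI)
  fix q :: real assume q: "q > 0"
  have "(\<lambda>x. H (q * x)) \<sim>[at_top] (\<lambda>x. F (q * x))"
    by (rule asymp_equiv_compose'[OF H(1) filterlim_scale_at_top[OF q]])
  hence "(\<lambda>x. H (q * x) / H x) \<sim>[at_top] (\<lambda>x. F (q * x) / F x)"
    by (intro asymp_equiv_intros H(1))
  from tendsto_asymp_equiv_cong[OF this] rv_ratio[OF F q]
  show "((\<lambda>x. H (q * x) / H x) \<longlongrightarrow> q powr - \<beta>) at_top" by simp
qed (use H in auto)

lemma rv_cmult:
  assumes "rv F \<beta>" "c > 0"
  shows "rv (\<lambda>x. c * F x) \<beta>"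
  using assms by (auto simp: rv_def)

lemma rv_scale:
  assumes "rv F \<beta>" "q > 0"
  shows "rv (\<lambda>x. F (q * x)) \<beta>"
  by (rule rv_asymp_equiv[OF rv_cmult rv_scale_asymp])
     (use assms rv_nonneg in auto)

text \<open>With no cancellation each summand is dominated by the sum, so errors small relative to
  the parts are small relative to the whole.\<close>

lemma asymp_equiv_add_nonneg:
  fixes f1 f2 g1 g2 :: "real \<Rightarrow> real"
  assumes "f1 \<sim>[at_top] g1" "f2 \<sim>[at_top] g2" "\<And>x. g1 x \<ge> 0" "\<And>x. g2 x \<ge> 0"
  shows "(\<lambda>x. f1 x + f2 x) \<sim>[at_top] (\<lambda>x. g1 x + g2 x)"
proof (rule smallo_imp_asymp_equiv)
  have *: "(\<lambda>x. f1 x - g1 x) \<in> o(g1)" "(\<lambda>x. f2 x - g2 x) \<in> o(g2)"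
    using assms by (auto simp: asymp_equiv_altdef)
  have "g1 \<in> O(\<lambda>x. g1 x + g2 x)" "g2 \<in> O(\<lambda>x. g1 x + g2 x)"
    using assms(3,4) by (auto intro!: bigoI[of _ 1] simp: abs_of_nonneg add_nonneg_nonneg)
  hence "(\<lambda>x. (f1 x - g1 x) + (f2 x - g2 x)) \<in> o(\<lambda>x. g1 x + g2 x)"
    using * by (intro sum_in_smallo(1)) (auto intro: landau_o.small_big_trans)
  thus "(\<lambda>x. f1 x + f2 x - (g1 x + g2 x)) \<in> o(\<lambda>x. g1 x + g2 x)"
    by (simp add: algebra_simps)
qed

text \<open>Both summands pick up the same factor \<open>q powr (-\<beta>)\<close>, which cancels
  even when neither function dominates the other. A sum of two tails need not be a tail, which is
  why \<open>rv\<close> speaks of plain functions.\<close>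

lemma rv_add:
  assumes "rv F \<beta>" "rv G \<beta>"
  shows "rv (\<lambda>x. F x + G x) \<beta>"
  unfolding rv_def
proof (intro conjI allI impI)
  show "F x + G x \<ge> 0" for x using assms by (simp add: rv_nonneg add_nonneg_nonneg)
  fix q :: real assume q: "q > 0"
  have "(\<lambda>x. F (q * x) + G (q * x)) \<sim>[at_top] (\<lambda>x. q powr (-\<beta>) * F x + q powr (-\<beta>) * G x)"
    using assms q by (intro asymp_equiv_add_nonneg rv_scale_asymp) (auto simp: rv_nonneg)
  hence "(\<lambda>x. (F (q * x) + G (q * x)) / (F x + G x)) \<sim>[at_top]
         (\<lambda>x. (q powr (-\<beta>) * F x + q powr (-\<beta>) * G x) / (F x + G x))"
    by (intro asymp_equiv_intros)
  moreover have "((\<lambda>x. (q powr (-\<beta>) * F x + q powr (-\<beta>) * G x) / (F x + G x)) \<longlongrightarrow> q powr (-\<beta>)) at_top"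
  proof (rule tendsto_eventually)
    show "\<forall>\<^sub>F x in at_top. (q powr - \<beta> * F x + q powr - \<beta> * G x) / (F x + G x) = q powr - \<beta>"
      using rv_eventually_pos[OF assms(1)] rv_eventually_pos[OF assms(2)]
      by eventually_elim (simp add: divide_simps, simp add: algebra_simps)
  qed
  ultimately show "((\<lambda>x. (F (q * x) + G (q * x)) / (F x + G x)) \<longlongrightarrow> q powr (-\<beta>)) at_top"
    by (simp add: tendsto_asymp_equiv_cong)
qed

text \<open>Rescaling the argument by \<eta> costs a factor \<eta>^(+-\<beta>) in the limit, and
  this tends to 1 as \<eta> decreases to 1. Slack in the argument and an error o(F) are thus
  harmless; both probabilistic comparisons below are brought into this form.\<close>

lemma rv_sandwich:
  assumes F: "rv F \<beta>"
    and upper: "\<And>\<eta>. \<eta> > 1 \<Longrightarrow> \<exists>E. E \<in> o(F) \<and> eventually (\<lambda>x. H x \<le> F (inverse \<eta> * x) + E x) at_top"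
    and lower: "\<And>\<eta>. \<eta> > 1 \<Longrightarrow> \<exists>E. E \<in> o(F) \<and> eventually (\<lambda>x. H x \<ge> F (\<eta> * x) - E x) at_top"
  shows "H \<sim>[at_top] F"
proof (rule asymp_equivI', rule order_tendstoI)
  have lim: "((\<lambda>\<eta>. \<eta> powr c) \<longlongrightarrow> 1) (at_right (1::real))" for c :: real
    by (rule tendsto_eq_intros refl | simp)+
  have E0: "((\<lambda>x. E x / F x) \<longlongrightarrow> 0) at_top" if "E \<in> o(F)" for E
    by (rule smalloD_tendsto[OF that])
  fix a :: real
  {
    assume a: "a < 1"
    have "eventually (\<lambda>\<eta>. \<eta> powr (-\<beta>) > a \<and> \<eta> > 1) (at_right (1::real))"
      using order_tendstoD(1)[OF lim a] by (intro eventually_conj eventually_at_right_less)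
    then obtain \<eta> where \<eta>: "\<eta> powr (-\<beta>) > a" "\<eta> > 1"
      using eventually_happens'[OF trivial_limit_at_right_real] by blast
    obtain E where E: "E \<in> o(F)" "eventually (\<lambda>x. H x \<ge> F (\<eta> * x) - E x) at_top"
      using lower[OF \<eta>(2)] by blast
    have "((\<lambda>x. F (\<eta> * x) / F x - E x / F x) \<longlongrightarrow> \<eta> powr (-\<beta>) - 0) at_top"
      using \<eta> by (intro tendsto_diff rv_ratio[OF F] E0 E) auto
    hence "eventually (\<lambda>x. F (\<eta> * x) / F x - E x / F x > a) at_top"
      using \<eta> by (intro order_tendstoD(1)) auto
    thus "eventually (\<lambda>x. a < H x / F x) at_top" using E(2) rv_eventually_pos[OF F]
    proof eventually_elim
      case (elim x)
      have "a < (F (\<eta> * x) - E x) / F x" using elim by (simp add: diff_divide_distrib)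
      also have "\<dots> \<le> H x / F x" using elim by (intro divide_right_mono) auto
      finally show ?case .
    qed
  next
    assume a: "a > 1"
    have "eventually (\<lambda>\<eta>. \<eta> powr \<beta> < a \<and> \<eta> > 1) (at_right (1::real))"
      using order_tendstoD(2)[OF lim a] by (intro eventually_conj eventually_at_right_less)
    then obtain \<eta> where \<eta>: "\<eta> powr \<beta> < a" "\<eta> > 1"
      using eventually_happens'[OF trivial_limit_at_right_real] by blast
    obtain E where E: "E \<in> o(F)" "eventually (\<lambda>x. H x \<le> F (inverse \<eta> * x) + E x) at_top"
      using upper[OF \<eta>(2)] by blast
    have "((\<lambda>x. F (inverse \<eta> * x) / F x + E x / F x) \<longlongrightarrow> inverse \<eta> powr (-\<beta>) + 0) at_top"
      using \<eta> by (intro tendsto_add rv_ratio[OF F] E0 E) auto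
    moreover have "inverse \<eta> powr (-\<beta>) = \<eta> powr \<beta>"
      using \<eta> by (simp add: powr_minus flip: inverse_powr)
    ultimately have "eventually (\<lambda>x. F (inverse \<eta> * x) / F x + E x / F x < a) at_top"
      using \<eta> by (intro order_tendstoD(2)) auto
    thus "eventually (\<lambda>x. a > H x / F x) at_top" using E(2) rv_eventually_pos[OF F]
    proof eventually_elim
      case (elim x)
      have "H x / F x \<le> (F (inverse \<eta> * x) + E x) / F x" using elim by (intro divide_right_mono) auto
      also have "\<dots> < a" using elim by (simp add: add_divide_distrib)
      finally show ?case .
    qed
  }
qed

subsection \<open>Tails of sums of independent variables\<close>

definition tail :: "'a measure \<Rightarrow> ('a \<Rightarrow> real) \<Rightarrow> real \<Rightarrow> real" where
  "tail M Y x = measure M {\<omega>\<in>space M. Y \<omega> > x}"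

lemma regvar_iff_rv: "regvar M Y \<beta> \<longleftrightarrow> \<beta> \<ge> 0 \<and> rv (tail M Y) \<beta>"
  by (auto simp: regvar_def rv_def tail_def[abs_def])

lemma tail_nonneg [simp]: "tail M Y x \<ge> 0"
  by (simp add: tail_def)

context prob_space
begin

lemma tail_mono:
  assumes [measurable]: "U \<in> borel_measurable M" "V \<in> borel_measurable M"
    and "\<And>\<omega>. \<omega> \<in> space M \<Longrightarrow> U \<omega> > x \<Longrightarrow> V \<omega> > y"
  shows "tail M U x \<le> tail M V y"
  unfolding tail_def by (rule finite_measure_mono) (use assms(3) in auto)

lemma tail_antimono:
  assumes "U \<in> borel_measurable M" "x \<le> y"
  shows "tail M U y \<le> tail M U x"
  using assms by (intro tail_mono) auto

lemma tail_tendsto_0: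
  assumes [measurable]: "Y \<in> borel_measurable M"
  shows "(tail M Y \<longlongrightarrow> 0) at_top"
proof -
  interpret D: real_distribution "distr M borel Y" by (rule real_distribution_distr) simp
  have "tail M Y x = 1 - cdf (distr M borel Y) x" for x
  proof -
    have "cdf (distr M borel Y) x = prob {\<omega>\<in>space M. Y \<omega> \<le> x}"
      by (auto simp: cdf_def measure_distr intro!: arg_cong[where f = prob])
    also have "{\<omega>\<in>space M. Y \<omega> \<le> x} = space M - {\<omega>\<in>space M. Y \<omega> > x}" by auto
    also have "prob \<dots> = 1 - tail M Y x"
      unfolding tail_def by (rule prob_compl) measurable
    finally show ?thesis by simp
  qed
  hence *: "tail M Y = (\<lambda>x. 1 - cdf (distr M borel Y) x)" by auto
  have "((\<lambda>x. 1 - cdf (distr M borel Y) x) \<longlongrightarrow> 1 - 1) at_top"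
    by (intro tendsto_intros D.cdf_lim_at_top_prob)
  thus ?thesis unfolding * by simp
qed

lemma indep_var_tail:
  assumes "indep_var borel U borel (V :: 'a \<Rightarrow> real)"
  shows "prob {\<omega>\<in>space M. U \<omega> > a \<and> V \<omega> > b} = tail M U a * tail M V (b :: real)"
proof -
  have "prob ((\<lambda>x. (U x, V x)) -` ({a<..} \<times> {b<..}) \<inter> space M) =
    prob (U -` {a<..} \<inter> space M) * prob (V -` {b<..} \<inter> space M)"
    by (rule indep_varD[OF assms]) auto
  thus ?thesis unfolding tail_def
    by (simp add: vimage_def Int_def conj_ac)
qed

text \<open>A single big jump: the sum is large essentially only when exactly one summand is,
  because both being large has a probability of product order.\<close>

lemma tail_add_asymp:
  fixes U V :: "'a \<Rightarrow> real"
  assumes ind: "indep_var borel U borel V"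
    and nonneg: "\<And>\<omega>. \<omega> \<in> space M \<Longrightarrow> U \<omega> \<ge> 0" "\<And>\<omega>. \<omega> \<in> space M \<Longrightarrow> V \<omega> \<ge> 0"
    and rv: "rv (tail M U) \<beta>" "rv (tail M V) \<beta>"
  shows "tail M (\<lambda>\<omega>. U \<omega> + V \<omega>) \<sim>[at_top] (\<lambda>x. tail M U x + tail M V x)"
proof (rule rv_sandwich[OF rv_add[OF rv]])
  have [measurable]: "U \<in> borel_measurable M" "V \<in> borel_measurable M"
    using ind indep_var_rv1 indep_var_rv2 by blast+
  let ?F = "\<lambda>x. tail M U x + tail M V x"
  \<comment> \<open>By independence this is the probability that both variables exceed \<delta> x.
    One factor is of the order of the tail of \<open>U\<close>, the other tends to 0.\<close>
  let ?E = "\<lambda>\<delta> x. tail M U (\<delta> * x) * tail M V (\<delta> * x)"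
  have E: "?E \<delta> \<in> o(?F)" if "\<delta> > 0" for \<delta>
  proof -
    have "(\<lambda>x. tail M V (\<delta> * x)) \<in> o(\<lambda>_. 1)"
      using filterlim_compose[OF tail_tendsto_0 filterlim_scale_at_top[OF that]]
      by (auto intro!: smalloI_tendsto)
    hence "?E \<delta> \<in> o(\<lambda>x. tail M U x * 1)"
      by (intro landau_o.big_small_mult rv_scale_bigo[OF rv(1) that])
    moreover have "tail M U \<in> O(?F)"
      by (auto intro!: bigoI[of _ 1] simp: abs_of_nonneg add_nonneg_nonneg)
    ultimately show ?thesis by (auto intro: landau_o.small_big_trans)
  qed
  fix \<eta> :: real assume \<eta>: "\<eta> > 1"
  show "\<exists>E. E \<in> o(?F) \<and> (\<forall>\<^sub>F x in at_top. tail M (\<lambda>\<omega>. U \<omega> + V \<omega>) x \<le> ?F (inverse \<eta> * x) + E x)"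
  proof (intro exI conjI)
    show "?E (1 - inverse \<eta>) \<in> o(?F)" using \<eta> by (intro E) (auto simp: field_simps)
    show "\<forall>\<^sub>F x in at_top. tail M (\<lambda>\<omega>. U \<omega> + V \<omega>) x \<le> ?F (inverse \<eta> * x) + ?E (1 - inverse \<eta>) x"
    proof (intro always_eventually allI)
      fix x
      let ?A = "{\<omega>\<in>space M. U \<omega> > inverse \<eta> * x}" and ?B = "{\<omega>\<in>space M. V \<omega> > inverse \<eta> * x}"
      let ?C = "{\<omega>\<in>space M. U \<omega> > (1 - inverse \<eta>) * x \<and> V \<omega> > (1 - inverse \<eta>) * x}"
      \<comment> \<open>If neither variable exceeds x/\<eta> but the sum exceeds x, then each must
        exceed x - x/\<eta>.\<close>
      have "tail M (\<lambda>\<omega>. U \<omega> + V \<omega>) x \<le> prob ((?A \<union> ?B) \<union> ?C)"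
        unfolding tail_def by (rule finite_measure_mono) (auto simp: algebra_simps)
      also have "\<dots> \<le> prob (?A \<union> ?B) + prob ?C" by (rule measure_Un_le) auto
      also have "prob (?A \<union> ?B) \<le> prob ?A + prob ?B" by (rule measure_Un_le) auto
      finally show "tail M (\<lambda>\<omega>. U \<omega> + V \<omega>) x \<le> ?F (inverse \<eta> * x) + ?E (1 - inverse \<eta>) x"
        unfolding indep_var_tail[OF ind] by (simp add: tail_def)
    qed
  qed
  show "\<exists>E. E \<in> o(?F) \<and> (\<forall>\<^sub>F x in at_top. tail M (\<lambda>\<omega>. U \<omega> + V \<omega>) x \<ge> ?F (\<eta> * x) - E x)"
  proof (intro exI conjI)
    show "?E 1 \<in> o(?F)" by (intro E) auto
    show "\<forall>\<^sub>F x in at_top. tail M (\<lambda>\<omega>. U \<omega> + V \<omega>) x \<ge> ?F (\<eta> * x) - ?E 1 x"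
      using eventually_ge_at_top[of 0]
    proof eventually_elim
      case (elim x)
      let ?A = "{\<omega>\<in>space M. U \<omega> > x}" and ?B = "{\<omega>\<in>space M. V \<omega> > x}"
      have "x * 1 \<le> x * \<eta>" using \<eta> elim by (intro mult_left_mono) auto
      hence "?F (\<eta> * x) \<le> ?F x" by (intro add_mono tail_antimono) (auto simp: mult.commute)
      \<comment> \<open>Inclusion-exclusion; for nonnegative variables one of them exceeding x
        already makes the sum exceed x.\<close>
      also have "\<dots> - ?E 1 x = prob ?A + prob ?B - prob {\<omega>\<in>space M. U \<omega> > x \<and> V \<omega> > x}"
        unfolding indep_var_tail[OF ind] by (simp add: tail_def)
      also have "{\<omega>\<in>space M. U \<omega> > x \<and> V \<omega> > x} = ?A \<inter> ?B" by auto
      also have "prob ?A + prob ?B - prob (?A \<inter> ?B) = prob (?A \<union> ?B)"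
        by (subst measure_Un3) (auto simp: fmeasurable_eq_sets)
      also have "\<dots> \<le> tail M (\<lambda>\<omega>. U \<omega> + V \<omega>) x"
        unfolding tail_def by (rule finite_measure_mono) (use nonneg in fastforce)+
      finally show ?case by simp
    qed
  qed
qed

lemma tail_cmult:
  assumes "c > 0"
  shows "tail M (\<lambda>\<omega>. c * Y \<omega>) = (\<lambda>x. tail M Y (inverse c * x))"
  using assms by (auto simp: tail_def fun_eq_iff field_simps)

lemma tail_cmult_asymp:
  assumes "c > 0" "rv (tail M Y) \<beta>"
  shows "tail M (\<lambda>\<omega>. c * Y \<omega>) \<sim>[at_top] (\<lambda>x. c powr \<beta> * tail M Y x)"
  using rv_scale_asymp[OF assms(2), of "inverse c"] assms(1)
  by (simp add: tail_cmult powr_minus flip: inverse_powr)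

lemma rv_tail_cmult:
  assumes "c > 0" "rv (tail M Y) \<beta>"
  shows "rv (tail M (\<lambda>\<omega>. c * Y \<omega>)) \<beta>"
  using assms by (simp add: tail_cmult rv_scale)

lemma tail_sum_asymp:
  fixes Y :: "'i \<Rightarrow> 'a \<Rightarrow> real"
  assumes "finite I" "I \<noteq> {}" "indep_vars (\<lambda>_. borel) Y I"
    and "\<And>i. i \<in> I \<Longrightarrow> rv (tail M (Y i)) \<beta>"
    and "\<And>i \<omega>. i \<in> I \<Longrightarrow> \<omega> \<in> space M \<Longrightarrow> Y i \<omega> \<ge> 0"
  shows "tail M (\<lambda>\<omega>. \<Sum>i\<in>I. Y i \<omega>) \<sim>[at_top] (\<lambda>x. \<Sum>i\<in>I. tail M (Y i) x) \<and>
         rv (tail M (\<lambda>\<omega>. \<Sum>i\<in>I. Y i \<omega>)) \<beta>"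
  using assms
proof (induction I rule: finite_ne_induct)
  case (singleton i)
  thus ?case by simp
next
  case (insert i I)
  have IH: "tail M (\<lambda>\<omega>. \<Sum>i\<in>I. Y i \<omega>) \<sim>[at_top] (\<lambda>x. \<Sum>i\<in>I. tail M (Y i) x)"
       "rv (tail M (\<lambda>\<omega>. \<Sum>i\<in>I. Y i \<omega>)) \<beta>"
    using insert.IH indep_vars_subset[OF insert.prems(1), of I] insert.prems(2,3) by auto
  have 1: "tail M (\<lambda>\<omega>. Y i \<omega> + (\<Sum>i\<in>I. Y i \<omega>)) \<sim>[at_top]
        (\<lambda>x. tail M (Y i) x + tail M (\<lambda>\<omega>. \<Sum>i\<in>I. Y i \<omega>) x)"
    using insert.hyps insert.prems IH
    by (intro tail_add_asymp[where \<beta> = \<beta>] indep_vars_sum) (auto intro!: sum_nonneg)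
  also have "\<dots> \<sim>[at_top] (\<lambda>x. tail M (Y i) x + (\<Sum>i\<in>I. tail M (Y i) x))"
    by (intro asymp_equiv_add_nonneg IH) (auto intro!: sum_nonneg)
  finally show ?case
    using rv_asymp_equiv[OF rv_add[OF _ IH(2)] 1] insert by simp
qed

lemma tail_linear_combination_asymp:
  fixes Y :: "'i \<Rightarrow> 'a \<Rightarrow> real"
  assumes I: "finite I" "\<exists>i\<in>I. c i > 0" and ind: "indep_vars (\<lambda>_. borel) Y I"
    and rv: "\<And>i. i \<in> I \<Longrightarrow> rv (tail M (Y i)) \<beta>"
    and nonneg: "\<And>i \<omega>. i \<in> I \<Longrightarrow> \<omega> \<in> space M \<Longrightarrow> Y i \<omega> \<ge> 0"
    and c: "\<And>i. i \<in> I \<Longrightarrow> c i \<ge> 0"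
  shows "tail M (\<lambda>\<omega>. \<Sum>i\<in>I. c i * Y i \<omega>) \<sim>[at_top] (\<lambda>x. \<Sum>i\<in>I. c i powr \<beta> * tail M (Y i) x)"
    and "rv (tail M (\<lambda>\<omega>. \<Sum>i\<in>I. c i * Y i \<omega>)) \<beta>"
proof -
  \<comment> \<open>A zero weight produces the zero variable, whose tail is not regularly varying,
    so only positive weights are passed to \<open>tail_sum_asymp\<close>.\<close>
  define J where "J = {i\<in>I. c i > 0}"
  have J: "finite J" "J \<noteq> {}" "J \<subseteq> I" using I by (auto simp: J_def)
  have c0: "c i = 0" if "i \<in> I - J" for i using that c[of i] by (auto simp: J_def)
  have eq: "(\<Sum>i\<in>I. c i * Y i \<omega>) = (\<Sum>i\<in>J. c i * Y i \<omega>)" for \<omega>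
    using J I c0 by (intro sum.mono_neutral_right) auto
  \<comment> \<open>\<open>0 powr \<beta>\<close> is 0 even for \<beta> = 0, so the dropped sources
    contribute nothing on this side either.\<close>
  have eq': "(\<Sum>i\<in>I. c i powr \<beta> * tail M (Y i) x) = (\<Sum>i\<in>J. c i powr \<beta> * tail M (Y i) x)" for x
    using J I c0 by (intro sum.mono_neutral_right) auto
  have ind': "indep_vars (\<lambda>_. borel) (\<lambda>i \<omega>. c i * Y i \<omega>) J"
    by (rule indep_vars_compose2[OF indep_vars_subset[OF ind J(3)]]) simp
  have rv': "rv (tail M (\<lambda>\<omega>. c i * Y i \<omega>)) \<beta>" if "i \<in> J" for i
    using that rv[of i] by (intro rv_tail_cmult) (auto simp: J_def)
  have *: "tail M (\<lambda>\<omega>. \<Sum>i\<in>J. c i * Y i \<omega>) \<sim>[at_top] (\<lambda>x. \<Sum>i\<in>J. tail M (\<lambda>\<omega>. c i * Y i \<omega>) x) \<and>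
         rv (tail M (\<lambda>\<omega>. \<Sum>i\<in>J. c i * Y i \<omega>)) \<beta>"
    using J ind' rv' nonneg by (intro tail_sum_asymp) (auto simp: J_def)
  show "rv (tail M (\<lambda>\<omega>. \<Sum>i\<in>I. c i * Y i \<omega>)) \<beta>" using * by (simp add: eq)
  have "(\<lambda>x. \<Sum>i\<in>J. tail M (\<lambda>\<omega>. c i * Y i \<omega>) x) \<sim>[at_top] (\<lambda>x. \<Sum>i\<in>J. c i powr \<beta> * tail M (Y i) x)"
    using J(1)
  proof (rule finite_subset_induct[where A = J])
    fix i F assume "i \<in> J" "finite F" "i \<notin> F"
     and IH: "(\<lambda>x. \<Sum>i\<in>F. tail M (\<lambda>\<omega>. c i * Y i \<omega>) x) \<sim>[at_top] (\<lambda>x. \<Sum>i\<in>F. c i powr \<beta> * tail M (Y i) x)"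
    have "tail M (\<lambda>\<omega>. c i * Y i \<omega>) \<sim>[at_top] (\<lambda>x. c i powr \<beta> * tail M (Y i) x)"
      using \<open>i \<in> J\<close> rv by (intro tail_cmult_asymp) (auto simp: J_def)
    from asymp_equiv_add_nonneg[OF this IH]
    show "(\<lambda>x. \<Sum>i\<in>insert i F. tail M (\<lambda>\<omega>. c i * Y i \<omega>) x) \<sim>[at_top]
          (\<lambda>x. \<Sum>i\<in>insert i F. c i powr \<beta> * tail M (Y i) x)"
      using \<open>finite F\<close> \<open>i \<notin> F\<close> by (simp add: sum_nonneg)
  qed auto
  with * show "tail M (\<lambda>\<omega>. \<Sum>i\<in>I. c i * Y i \<omega>) \<sim>[at_top] (\<lambda>x. \<Sum>i\<in>I. c i powr \<beta> * tail M (Y i) x)"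
    unfolding eq eq' using asymp_equiv_trans by blast
qed

end

subsection \<open>Moment bounds\<close>

lemma powr_abs_one_plus_le:
  fixes r :: real
  assumes r: "r > 1"
  obtains C where "C \<ge> 1"
    "\<And>t. \<bar>1 + t\<bar> powr r \<le> 1 + r * t + C * (\<bar>t\<bar> powr (min r 2) + \<bar>t\<bar> powr r)"
proof
  \<comment> \<open>For |t| > 1/2, 3^r comes from |1 + t| \<le> 3|t|, and r 2^r pays for a negative
    linear term. The last summand bounds the second derivative for |t| \<le> 1/2.\<close>
  define C where "C = 3 powr r + r * 2 powr r + r * (r - 1) * 2 powr (r + 2)"
  have C: "C \<ge> 3 powr r + r * 2 powr r" "C \<ge> r * (r - 1) * 2 powr (r + 2)"
    using r by (auto simp: C_def intro!: add_nonneg_nonneg)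
  have "1 \<le> 3 powr r" using r by (intro ge_one_powr_ge_zero) auto
  moreover have "r * 2 powr r \<ge> 0" using r by simp
  ultimately show C1: "C \<ge> 1" using C(1) by linarith
  fix t :: real
  show "\<bar>1 + t\<bar> powr r \<le> 1 + r * t + C * (\<bar>t\<bar> powr (min r 2) + \<bar>t\<bar> powr r)"
  proof (cases "\<bar>t\<bar> \<le> 1/2")
    case True
    define f where "f = (\<lambda>u::real. (1 + u) powr r)"
    define diff where "diff = (\<lambda>n::nat. \<lambda>u::real. if n = 0 then (1 + u) powr r
      else if n = 1 then r * (1 + u) powr (r - 1) else r * (r - 1) * (1 + u) powr (r - 2))"
    have "f t \<le> 1 + r * t + r * (r - 1) * 2 powr (r + 2) * t\<^sup>2"
    proof (cases "t = 0")
      case False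
      have "\<exists>u. (if t < 0 then t < u \<and> u < 0 else 0 < u \<and> u < t) \<and>
          f t = (\<Sum>m<2. diff m 0 / fact m * (t - 0) ^ m) + diff 2 u / fact 2 * (t - 0) ^ 2"
      proof (rule Taylor[where a = "-1/2" and b = "1/2"])
        show "\<forall>m u. m < 2 \<and> - 1 / 2 \<le> u \<and> u \<le> 1 / 2 \<longrightarrow> DERIV (diff m) u :> diff (Suc m) u"
        proof (intro allI impI)
          fix m :: nat and u :: real assume *: "m < 2 \<and> - 1 / 2 \<le> u \<and> u \<le> 1 / 2"
          hence "m = 0 \<or> m = 1" by auto
          thus "DERIV (diff m) u :> diff (Suc m) u"
          proof
            assume "m = 0"
            thus ?thesis using * unfolding diff_def by (auto intro!: derivative_eq_intros)
          next
            assume "m = 1"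
            thus ?thesis using * unfolding diff_def by (auto intro!: derivative_eq_intros)
          qed
        qed
      qed (use True False in \<open>auto simp: f_def diff_def\<close>)
      then obtain u where u: "if t < 0 then t < u \<and> u < 0 else 0 < u \<and> u < t"
        and eq: "f t = (\<Sum>m<2. diff m 0 / fact m * (t - 0) ^ m) + diff 2 u / fact 2 * (t - 0) ^ 2"
        by blast
      have u': "1 + u \<ge> 1 / 2" "1 + u \<le> 2" using u True by (auto split: if_splits)
      \<comment> \<open>The base lies between 1/2 and 2, and the sign of r - 2 decides which end is
        extreme; the right-hand side majorises both outcomes.\<close>
      have "(1 + u) powr (r - 2) \<le> 2 powr (r + 2)"
      proof (cases "r \<ge> 2")
        case True
        have "(1 + u) powr (r - 2) \<le> 2 powr (r - 2)" using u' True by (intro powr_mono2) auto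
        also have "\<dots> \<le> 2 powr (r + 2)" by (intro powr_mono) auto
        finally show ?thesis .
      next
        case False
        have "(1 + u) powr (r - 2) \<le> (1/2) powr (r - 2)" using u' False by (intro powr_mono2') auto
        also have "\<dots> = 2 powr (2 - r)" by (simp add: powr_divide powr_minus[symmetric] powr_diff)
        also have "\<dots> \<le> 2 powr (r + 2)" using r by (intro powr_mono) auto
        finally show ?thesis .
      qed
      hence "r * (r - 1) * (1 + u) powr (r - 2) / 2 * t\<^sup>2 \<le> r * (r - 1) * 2 powr (r + 2) / 1 * t\<^sup>2"
        using r by (intro mult_right_mono frac_le mult_left_mono) auto
      thus ?thesis unfolding eq by (simp add: diff_def numeral_2_eq_2)
    qed (simp add: f_def)
    also have "r * (r - 1) * 2 powr (r + 2) * t\<^sup>2 \<le> C * (\<bar>t\<bar> powr (min r 2) + \<bar>t\<bar> powr r)"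
    proof (rule mult_mono[OF C(2)])
      have "t\<^sup>2 = \<bar>t\<bar> powr 2" by (simp add: powr_numeral flip: powr_realpow')
      also have "\<dots> \<le> \<bar>t\<bar> powr (min r 2)" using True by (intro powr_mono') auto
      finally show "t\<^sup>2 \<le> \<bar>t\<bar> powr (min r 2) + \<bar>t\<bar> powr r"
        by (simp add: add_increasing2)
    qed (use C1 in auto)
    finally show ?thesis using True by (simp add: f_def)
  next
    case False
    have "\<bar>1 + t\<bar> powr r \<le> (3 * \<bar>t\<bar>) powr r" using False r by (intro powr_mono2) auto
    also have "\<dots> = 3 powr r * \<bar>t\<bar> powr r" by (simp add: powr_mult)
    finally have 1: "\<bar>1 + t\<bar> powr r \<le> 3 powr r * \<bar>t\<bar> powr r" .
    \<comment> \<open>Since 2|t| \<ge> 1, the linear term can be absorbed into the r-th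
      power.\<close>
    have "\<bar>t\<bar> * 1 \<le> \<bar>t\<bar> * (2 * \<bar>t\<bar>) powr (r - 1)"
      using False r by (intro mult_left_mono ge_one_powr_ge_zero) auto
    also have "\<dots> = 2 powr (r - 1) * (\<bar>t\<bar> powr 1 * \<bar>t\<bar> powr (r - 1))" by (simp add: powr_mult)
    also have "\<bar>t\<bar> powr 1 * \<bar>t\<bar> powr (r - 1) = \<bar>t\<bar> powr r" by (subst powr_add[symmetric]) simp
    also have "2 powr (r - 1) * \<bar>t\<bar> powr r \<le> 2 powr r * \<bar>t\<bar> powr r"
      by (intro mult_right_mono powr_mono) auto
    finally have "r * \<bar>t\<bar> \<le> r * (2 powr r * \<bar>t\<bar> powr r)" using r by (intro mult_left_mono) auto
    moreover have "- (r * t) \<le> r * \<bar>t\<bar>" using r abs_ge_minus_self[of t]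
      by (metis abs_ge_minus_self abs_mult abs_of_pos less_trans zero_less_one)
    moreover have "(3 powr r + r * 2 powr r) * \<bar>t\<bar> powr r \<le> C * (\<bar>t\<bar> powr (min r 2) + \<bar>t\<bar> powr r)"
      using C1 by (intro mult_mono C) auto
    ultimately show ?thesis using 1 by (simp add: algebra_simps)
  qed
qed

text \<open>The previous inequality at t = b/a, made homogeneous by the factor |a|^r. The
  coefficient of b is the derivative of |a|^r; when a and b come from independent variables and b is
  centred, that term has mean zero.\<close>

lemma powr_abs_add_le:
  fixes r :: real
  assumes r: "r > 1"
  obtains C where "C \<ge> 1"
    "\<And>a b. \<bar>a + b\<bar> powr r \<le> \<bar>a\<bar> powr r + r * (sgn a * \<bar>a\<bar> powr (r - 1)) * b
        + C * (\<bar>a\<bar> powr (r - min r 2) * \<bar>b\<bar> powr (min r 2) + \<bar>b\<bar> powr r)"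
proof -
  obtain C where C: "C \<ge> 1"
    "\<And>t. \<bar>1 + t\<bar> powr r \<le> 1 + r * t + C * (\<bar>t\<bar> powr (min r 2) + \<bar>t\<bar> powr r)"
    using powr_abs_one_plus_le[OF r] by blast
  show ?thesis
  proof (rule that[OF C(1)])
    fix a b :: real
    show "\<bar>a + b\<bar> powr r \<le> \<bar>a\<bar> powr r + r * (sgn a * \<bar>a\<bar> powr (r - 1)) * b
        + C * (\<bar>a\<bar> powr (r - min r 2) * \<bar>b\<bar> powr (min r 2) + \<bar>b\<bar> powr r)"
    proof (cases "a = 0")
      case True
      have "1 * \<bar>b\<bar> powr r \<le> C * \<bar>b\<bar> powr r" using C by (intro mult_right_mono) auto
      thus ?thesis using True by simp
    next
      case False
      define t where "t = b / a"
      have ab: "a + b = a * (1 + t)" "b = a * t" using False by (auto simp: t_def field_simps)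
      have "\<bar>a + b\<bar> powr r = \<bar>a\<bar> powr r * \<bar>1 + t\<bar> powr r"
        unfolding ab(1) by (simp add: abs_mult powr_mult)
      also have "\<dots> \<le> \<bar>a\<bar> powr r * (1 + r * t + C * (\<bar>t\<bar> powr (min r 2) + \<bar>t\<bar> powr r))"
        by (intro mult_left_mono C) auto
      also have "\<dots> = \<bar>a\<bar> powr r + r * (\<bar>a\<bar> powr r * t) +
                  C * (\<bar>a\<bar> powr r * \<bar>t\<bar> powr (min r 2) + \<bar>a\<bar> powr r * \<bar>t\<bar> powr r)"
        by (simp add: algebra_simps)
      also have "\<bar>a\<bar> powr r * t = (sgn a * \<bar>a\<bar> powr (r - 1)) * b"
        using False by (simp add: t_def powr_diff abs_if sgn_if)
      also have "\<bar>a\<bar> powr r * \<bar>t\<bar> powr r = \<bar>b\<bar> powr r"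
        unfolding ab(2) by (simp add: abs_mult powr_mult)
      also have "\<bar>a\<bar> powr r * \<bar>t\<bar> powr (min r 2) = \<bar>a\<bar> powr (r - min r 2) * \<bar>b\<bar> powr (min r 2)"
        unfolding ab(2) using False by (simp add: abs_mult powr_mult powr_diff)
      finally show ?thesis by (simp add: mult.assoc)
    qed
  qed
qed

text \<open>Jensen's inequality for the r-th power with equal weights. Zero terms are removed first,
  so that convexity is applied at positive points only.\<close>

lemma powr_abs_sum_le:
  fixes y :: "'i \<Rightarrow> real"
  assumes I: "finite I" and r: "r \<ge> 1"
  shows "\<bar>\<Sum>i\<in>I. y i\<bar> powr r \<le> real (card I) powr (r - 1) * (\<Sum>i\<in>I. \<bar>y i\<bar> powr r)"
proof -
  define J where "J = {i\<in>I. y i \<noteq> 0}"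
  have J: "finite J" "J \<subseteq> I" using I by (auto simp: J_def)
  have eq: "(\<Sum>i\<in>I. y i) = (\<Sum>i\<in>J. y i)" "(\<Sum>i\<in>I. \<bar>y i\<bar> powr r) = (\<Sum>i\<in>J. \<bar>y i\<bar> powr r)"
    by (rule sum.mono_neutral_right, use I in \<open>auto simp: J_def\<close>)+
  show ?thesis
  proof (cases "J = {}")
    case True
    thus ?thesis unfolding eq by simp
  next
    case False
    define n where "n = real (card J)"
    have n: "n > 0" using False J by (auto simp: n_def card_gt_0_iff)
    have "(\<Sum>i\<in>J. (1 / n) *\<^sub>R \<bar>y i\<bar>) powr r \<le> (\<Sum>i\<in>J. (1 / n) * \<bar>y i\<bar> powr r)"
      using n J False by (intro convex_on_sum[OF _ _ powr_convex[OF r]]) (auto simp: J_def n_def)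
    hence "((\<Sum>i\<in>J. \<bar>y i\<bar>) / n) powr r \<le> (\<Sum>i\<in>J. \<bar>y i\<bar> powr r) / n"
      by (simp flip: sum_divide_distrib)
    also have "((\<Sum>i\<in>J. \<bar>y i\<bar>) / n) powr r = (\<Sum>i\<in>J. \<bar>y i\<bar>) powr r / n powr r"
      using n by (simp add: powr_divide sum_nonneg)
    finally have "(\<Sum>i\<in>J. \<bar>y i\<bar>) powr r \<le> n powr (r - 1) * (\<Sum>i\<in>J. \<bar>y i\<bar> powr r)"
      using n by (simp add: field_simps powr_diff)
    also have "\<dots> \<le> real (card I) powr (r - 1) * (\<Sum>i\<in>J. \<bar>y i\<bar> powr r)"
      using r n J I by (intro mult_right_mono powr_mono2) (auto simp: n_def sum_nonneg card_mono)
    finally have "(\<Sum>i\<in>J. \<bar>y i\<bar>) powr r \<le> real (card I) powr (r - 1) * (\<Sum>i\<in>J. \<bar>y i\<bar> powr r)" .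
    moreover have "\<bar>\<Sum>i\<in>J. y i\<bar> powr r \<le> (\<Sum>i\<in>J. \<bar>y i\<bar>) powr r"
      using r by (intro powr_mono2 sum_abs) auto
    ultimately show ?thesis unfolding eq by linarith
  qed
qed

section \<open>Moments of partial sums, truncated moments and random indices\<close>

context prob_space
begin

lemma integrable_powr_le:
  fixes Y :: "'a \<Rightarrow> real" and q r :: real
  assumes [measurable]: "Y \<in> borel_measurable M"
    and "integrable M (\<lambda>\<omega>. \<bar>Y \<omega>\<bar> powr r)" "0 \<le> q" "q \<le> r"
  shows "integrable M (\<lambda>\<omega>. \<bar>Y \<omega>\<bar> powr q)"
    and "expectation (\<lambda>\<omega>. \<bar>Y \<omega>\<bar> powr q) \<le> 1 + expectation (\<lambda>\<omega>. \<bar>Y \<omega>\<bar> powr r)"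
proof -
  have le: "\<bar>y\<bar> powr q \<le> 1 + \<bar>y\<bar> powr r" for y :: real
  proof (cases "\<bar>y\<bar> \<le> 1")
    case True
    hence "\<bar>y\<bar> powr q \<le> 1" using assms by (intro powr_le1) auto
    thus ?thesis using powr_ge_zero[of "\<bar>y\<bar>" r] by linarith
  next
    case False
    hence "\<bar>y\<bar> powr q \<le> \<bar>y\<bar> powr r" using assms by (intro powr_mono) auto
    thus ?thesis by linarith
  qed
  have int: "integrable M (\<lambda>\<omega>. 1 + \<bar>Y \<omega>\<bar> powr r)" using assms by auto
  show *: "integrable M (\<lambda>\<omega>. \<bar>Y \<omega>\<bar> powr q)"
    by (rule Bochner_Integration.integrable_bound[OF int]) (use le in \<open>auto simp: add_nonneg_nonneg\<close>)
  have "expectation (\<lambda>\<omega>. \<bar>Y \<omega>\<bar> powr q) \<le> expectation (\<lambda>\<omega>. 1 + \<bar>Y \<omega>\<bar> powr r)"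
    by (intro integral_mono * int le)
  also have "\<dots> = 1 + expectation (\<lambda>\<omega>. \<bar>Y \<omega>\<bar> powr r)"
    using assms by (simp add: prob_space)
  finally show "expectation (\<lambda>\<omega>. \<bar>Y \<omega>\<bar> powr q) \<le> 1 + expectation (\<lambda>\<omega>. \<bar>Y \<omega>\<bar> powr r)" .
qed


text \<open>Adding one summand changes the r-th moment only by the remainder of
  \<open>powr_abs_add_le\<close>, as independence and centring remove the linear term. For r \<le> 2
  this gives growth linear in k, as in the inequality of von Bahr and Esseen. The remainder involves
  E|S_k|^(r-s), for which the crude rate k^(r-s) from Jensen's inequality suffices.\<close>

lemma moment_partial_sum_le:
  fixes Y :: "nat \<Rightarrow> 'a \<Rightarrow> real" and r B :: real
  assumes ind: "indep_vars (\<lambda>_. borel) Y {1..}" and r: "r > 1"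
    and int: "\<And>i. i \<ge> 1 \<Longrightarrow> integrable M (\<lambda>\<omega>. \<bar>Y i \<omega>\<bar> powr r)"
    and B: "\<And>i. i \<ge> 1 \<Longrightarrow> expectation (\<lambda>\<omega>. \<bar>Y i \<omega>\<bar> powr r) \<le> B"
    and mean: "\<And>i. i \<ge> 1 \<Longrightarrow> expectation (Y i) = 0"
  obtains C where "C \<ge> 0"
    "\<And>k. integrable M (\<lambda>\<omega>. \<bar>\<Sum>i=1..k. Y i \<omega>\<bar> powr r)"
    "\<And>k. expectation (\<lambda>\<omega>. \<bar>\<Sum>i=1..k. Y i \<omega>\<bar> powr r) \<le> C * real k powr (r - min r 2 + 1)"
proof -
  define s where "s = min r 2"
  have s: "1 < s" "s \<le> r" "0 \<le> r - s" using r by (auto simp: s_def)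
  define S where "S = (\<lambda>k \<omega>. \<Sum>i=1..k. Y i \<omega>)"
  have meas: "Y i \<in> borel_measurable M" if "i \<ge> 1" for i
    using ind that by (auto simp: indep_vars_def)
  have measS [measurable]: "S k \<in> borel_measurable M" for k
    unfolding S_def by (intro borel_measurable_sum) (auto intro: meas)
  have B0: "B \<ge> 0"
    by (rule order_trans[OF Bochner_Integration.integral_nonneg B[of 1]]) auto
  have int_S: "integrable M (\<lambda>\<omega>. \<bar>S k \<omega>\<bar> powr r)"
    and E_S: "expectation (\<lambda>\<omega>. \<bar>S k \<omega>\<bar> powr r) \<le> real k powr r * B" for k
  proof -
    have le: "\<bar>S k \<omega>\<bar> powr r \<le> real k powr (r - 1) * (\<Sum>i=1..k. \<bar>Y i \<omega>\<bar> powr r)" for \<omega>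
      using powr_abs_sum_le[of "{1..k}" r "\<lambda>i. Y i \<omega>"] r by (simp add: S_def)
    have int': "integrable M (\<lambda>\<omega>. real k powr (r - 1) * (\<Sum>i=1..k. \<bar>Y i \<omega>\<bar> powr r))"
      using int by (intro integrable_mult_right Bochner_Integration.integrable_sum) auto
    show *: "integrable M (\<lambda>\<omega>. \<bar>S k \<omega>\<bar> powr r)"
      by (rule Bochner_Integration.integrable_bound[OF int'])
         (use le in \<open>auto simp: abs_mult sum_nonneg\<close>)
    have "expectation (\<lambda>\<omega>. \<bar>S k \<omega>\<bar> powr r) \<le>
        expectation (\<lambda>\<omega>. real k powr (r - 1) * (\<Sum>i=1..k. \<bar>Y i \<omega>\<bar> powr r))"
      by (intro integral_mono * int' le)
    also have "\<dots> = real k powr (r - 1) * (\<Sum>i=1..k. expectation (\<lambda>\<omega>. \<bar>Y i \<omega>\<bar> powr r))"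
      using int by (simp add: Bochner_Integration.integral_sum)
    also have "\<dots> \<le> real k powr (r - 1) * (\<Sum>i=1..k. B)"
      using B by (intro mult_left_mono sum_mono) auto
    also have "\<dots> = real k powr r * B"
      by (cases "k = 0") (auto simp: powr_diff)
    finally show "expectation (\<lambda>\<omega>. \<bar>S k \<omega>\<bar> powr r) \<le> real k powr r * B" .
  qed
  have int_Ss: "integrable M (\<lambda>\<omega>. \<bar>S k \<omega>\<bar> powr (r - s))" for k
    using s by (intro integrable_powr_le(1)[OF _ int_S[of k]]) auto
  \<comment> \<open>The sum is divided by k before the exponent is lowered: applied to S_k itself,
    \<open>integrable_powr_le\<close> would only give the order k^r. For k = 0 both sides are 0,
    even when r = s.\<close>
  have E_Ss: "expectation (\<lambda>\<omega>. \<bar>S k \<omega>\<bar> powr (r - s)) \<le> (1 + B) * real k powr (r - s)" for k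
  proof (cases "k = 0")
    case True
    thus ?thesis by (simp add: S_def)
  next
    case False
    define x where "x = real k"
    have x: "x > 0" using False by (simp add: x_def)
    have int': "integrable M (\<lambda>\<omega>. \<bar>S k \<omega> / x\<bar> powr r)"
      using int_S[of k] x by (simp add: powr_divide)
    have "expectation (\<lambda>\<omega>. \<bar>S k \<omega>\<bar> powr (r - s)) = x powr (r - s) * expectation (\<lambda>\<omega>. \<bar>S k \<omega> / x\<bar> powr (r - s))"
      using x by (simp add: powr_divide)
    also have "\<dots> \<le> x powr (r - s) * (1 + expectation (\<lambda>\<omega>. \<bar>S k \<omega> / x\<bar> powr r))"
      using s by (intro mult_left_mono integrable_powr_le(2)[OF _ int']) auto
    also have "expectation (\<lambda>\<omega>. \<bar>S k \<omega> / x\<bar> powr r) = expectation (\<lambda>\<omega>. \<bar>S k \<omega>\<bar> powr r) / x powr r"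
      using x by (simp add: powr_divide)
    also have "\<dots> \<le> B" using E_S[of k] x by (simp add: x_def field_simps)
    finally show ?thesis by (simp add: x_def mult.commute mult_right_mono)
  qed
  obtain C where C: "C \<ge> 1"
    "\<And>a b. \<bar>a + b\<bar> powr r \<le> \<bar>a\<bar> powr r + r * (sgn a * \<bar>a\<bar> powr (r - 1)) * b
        + C * (\<bar>a\<bar> powr (r - s) * \<bar>b\<bar> powr s + \<bar>b\<bar> powr r)"
    using powr_abs_add_le[OF r] unfolding s_def by blast
  \<comment> \<open>One factor 1 + B bounds the s-th moment of the new summand, the other comes from
    \<open>E_Ss\<close>; the final B is the r-th moment of the new summand.\<close>
  define D where "D = C * ((1 + B) * (1 + B) + B)"
  have D: "D \<ge> 0" using C B0 by (simp add: D_def)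
  have step: "expectation (\<lambda>\<omega>. \<bar>S (Suc k) \<omega>\<bar> powr r) \<le>
     expectation (\<lambda>\<omega>. \<bar>S k \<omega>\<bar> powr r) + D * real (Suc k) powr (r - s)" for k
  proof -
    have Yk: "integrable M (\<lambda>\<omega>. \<bar>Y (Suc k) \<omega>\<bar> powr r)" by (rule int) simp
    have mY [measurable]: "Y (Suc k) \<in> borel_measurable M" by (rule meas) simp
    have iY: "integrable M (Y (Suc k))"
      using integrable_powr_le(1)[OF mY Yk, of 1] r
      by (intro integrable_abs_cancel[OF _ mY]) simp
    have iYs: "integrable M (\<lambda>\<omega>. \<bar>Y (Suc k) \<omega>\<bar> powr s)"
      using integrable_powr_le(1)[OF mY Yk, of s] s by simp
    have iSs': "integrable M (\<lambda>\<omega>. \<bar>S k \<omega>\<bar> powr (r - 1))"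
      using integrable_powr_le(1)[OF measS int_S[of k], of "r - 1"] r by simp
    have iS1: "integrable M (\<lambda>\<omega>. sgn (S k \<omega>) * \<bar>S k \<omega>\<bar> powr (r - 1))"
      by (rule Bochner_Integration.integrable_bound[OF iSs']) (auto simp: abs_mult sgn_if)
    have indk: "indep_var borel (Y (Suc k)) borel (S k)"
      unfolding S_def by (rule indep_vars_sum) (auto intro!: indep_vars_subset[OF ind])
    have ind1: "indep_var borel (Y (Suc k)) borel (\<lambda>\<omega>. sgn (S k \<omega>) * \<bar>S k \<omega>\<bar> powr (r - 1))"
      using indep_var_compose[OF indk, of "\<lambda>x. x" borel "\<lambda>x. sgn x * \<bar>x\<bar> powr (r - 1)" borel]
      by (simp add: comp_def)
    have ind2: "indep_var borel (\<lambda>\<omega>. \<bar>Y (Suc k) \<omega>\<bar> powr s) borel (\<lambda>\<omega>. \<bar>S k \<omega>\<bar> powr (r - s))"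
      using indep_var_compose[OF indk, of "\<lambda>x. \<bar>x\<bar> powr s" borel "\<lambda>x. \<bar>x\<bar> powr (r - s)" borel]
      by (simp add: comp_def)
    note int1 = indep_var_integrable[OF ind1 iY iS1]
    note int2 = indep_var_integrable[OF ind2 iYs int_Ss]
    have "expectation (\<lambda>\<omega>. \<bar>S (Suc k) \<omega>\<bar> powr r) \<le> expectation (\<lambda>\<omega>. \<bar>S k \<omega>\<bar> powr r
        + r * (Y (Suc k) \<omega> * (sgn (S k \<omega>) * \<bar>S k \<omega>\<bar> powr (r - 1)))
        + C * (\<bar>Y (Suc k) \<omega>\<bar> powr s * \<bar>S k \<omega>\<bar> powr (r - s) + \<bar>Y (Suc k) \<omega>\<bar> powr r))"
    proof (intro integral_mono int_S)
      fix \<omega>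
      show "\<bar>S (Suc k) \<omega>\<bar> powr r \<le> \<bar>S k \<omega>\<bar> powr r
        + r * (Y (Suc k) \<omega> * (sgn (S k \<omega>) * \<bar>S k \<omega>\<bar> powr (r - 1)))
        + C * (\<bar>Y (Suc k) \<omega>\<bar> powr s * \<bar>S k \<omega>\<bar> powr (r - s) + \<bar>Y (Suc k) \<omega>\<bar> powr r)"
        using C(2)[of "S k \<omega>" "Y (Suc k) \<omega>"] by (simp add: S_def mult_ac)
    qed (intro Bochner_Integration.integrable_add integrable_mult_right int_S int1 int2 Yk)
    also have "\<dots> = expectation (\<lambda>\<omega>. \<bar>S k \<omega>\<bar> powr r)
        + r * expectation (\<lambda>\<omega>. Y (Suc k) \<omega> * (sgn (S k \<omega>) * \<bar>S k \<omega>\<bar> powr (r - 1)))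
        + C * (expectation (\<lambda>\<omega>. \<bar>Y (Suc k) \<omega>\<bar> powr s * \<bar>S k \<omega>\<bar> powr (r - s))
           + expectation (\<lambda>\<omega>. \<bar>Y (Suc k) \<omega>\<bar> powr r))"
      using int_S[of k] int1 int2 Yk by simp
    finally have *: "expectation (\<lambda>\<omega>. \<bar>S (Suc k) \<omega>\<bar> powr r) \<le> expectation (\<lambda>\<omega>. \<bar>S k \<omega>\<bar> powr r)
        + r * expectation (\<lambda>\<omega>. Y (Suc k) \<omega> * (sgn (S k \<omega>) * \<bar>S k \<omega>\<bar> powr (r - 1)))
        + C * (expectation (\<lambda>\<omega>. \<bar>Y (Suc k) \<omega>\<bar> powr s * \<bar>S k \<omega>\<bar> powr (r - s))
           + expectation (\<lambda>\<omega>. \<bar>Y (Suc k) \<omega>\<bar> powr r))" .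
    have 1: "expectation (\<lambda>\<omega>. Y (Suc k) \<omega> * (sgn (S k \<omega>) * \<bar>S k \<omega>\<bar> powr (r - 1))) = 0"
      using mean[of "Suc k"] by (subst indep_var_lebesgue_integral[OF ind1 iY iS1]) simp
    have "expectation (\<lambda>\<omega>. \<bar>Y (Suc k) \<omega>\<bar> powr s * \<bar>S k \<omega>\<bar> powr (r - s)) =
       expectation (\<lambda>\<omega>. \<bar>Y (Suc k) \<omega>\<bar> powr s) * expectation (\<lambda>\<omega>. \<bar>S k \<omega>\<bar> powr (r - s))"
      by (rule indep_var_lebesgue_integral[OF ind2 iYs int_Ss])
    also have "\<dots> \<le> (1 + B) * ((1 + B) * real (Suc k) powr (r - s))"
    proof (rule mult_mono)
      have "real k powr (r - s) \<le> real (Suc k) powr (r - s)" using s by (intro powr_mono2) auto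
      hence "(1 + B) * real k powr (r - s) \<le> (1 + B) * real (Suc k) powr (r - s)"
        using B0 by (intro mult_left_mono) auto
      with E_Ss[of k] show "expectation (\<lambda>\<omega>. \<bar>S k \<omega>\<bar> powr (r - s)) \<le> (1 + B) * real (Suc k) powr (r - s)"
        by linarith
      show "expectation (\<lambda>\<omega>. \<bar>Y (Suc k) \<omega>\<bar> powr s) \<le> 1 + B"
        using integrable_powr_le(2)[OF mY Yk, of s] s B[of "Suc k"] by simp
    qed (use B0 in auto)
    finally have 2: "expectation (\<lambda>\<omega>. \<bar>Y (Suc k) \<omega>\<bar> powr s * \<bar>S k \<omega>\<bar> powr (r - s)) \<le>
       (1 + B) * ((1 + B) * real (Suc k) powr (r - s))" .
    \<comment> \<open>The power is taken at \<open>Suc k\<close> instead of k so that its base is at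
      least 1 and it can absorb constants, also in the first step.\<close>
    have "B * 1 \<le> B * real (Suc k) powr (r - s)"
      using B0 s by (intro mult_left_mono ge_one_powr_ge_zero) auto
    hence "expectation (\<lambda>\<omega>. \<bar>Y (Suc k) \<omega>\<bar> powr r) \<le> B * real (Suc k) powr (r - s)"
      using B[of "Suc k"] by simp
    with 2 have "C * (expectation (\<lambda>\<omega>. \<bar>Y (Suc k) \<omega>\<bar> powr s * \<bar>S k \<omega>\<bar> powr (r - s))
           + expectation (\<lambda>\<omega>. \<bar>Y (Suc k) \<omega>\<bar> powr r)) \<le>
        C * ((1 + B) * ((1 + B) * real (Suc k) powr (r - s)) + B * real (Suc k) powr (r - s))"
      using C by (intro mult_left_mono add_mono) auto
    also have "\<dots> = D * real (Suc k) powr (r - s)" unfolding D_def by (simp only: algebra_simps)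
    finally show ?thesis using * unfolding 1 by simp
  qed
  have "expectation (\<lambda>\<omega>. \<bar>S k \<omega>\<bar> powr r) \<le> D * (real k * real k powr (r - s))" for k
  proof (induction k)
    case (Suc k)
    have "real k powr (r - s) \<le> real (Suc k) powr (r - s)" using s by (intro powr_mono2) auto
    hence "D * (real k * real k powr (r - s)) \<le> D * (real k * real (Suc k) powr (r - s))"
      using D by (intro mult_left_mono) auto
    with Suc step[of k] show ?case by (simp add: algebra_simps)
  qed (simp add: S_def)
  moreover have "real k * real k powr (r - s) = real k powr (r - min r 2 + 1)" for k
    by (cases "k = 0") (auto simp: powr_add s_def)
  ultimately show ?thesis using that[of D] D int_S by (simp add: S_def)
qed

text \<open>A Karamata-type estimate that uses regular variation only for the factor 2: passing from
  x to 2x adds at most a multiple of x^p P(N > x), while for large x the claimed bound grows by at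
  least a fixed factor above 1. Induction over dyadic scales then gives a uniform constant.\<close>

lemma truncated_moment_le_tail:
  fixes N :: "'a \<Rightarrow> real"
  assumes [measurable]: "N \<in> borel_measurable M" and nonneg: "\<And>\<omega>. \<omega> \<in> space M \<Longrightarrow> N \<omega> \<ge> 0"
    and rv: "rv (tail M N) \<beta>" and p: "p > \<beta>" "p > 0"
  obtains K x0 where "K \<ge> 0" "x0 > 0"
    "\<And>x. x \<ge> x0 \<Longrightarrow> expectation (\<lambda>\<omega>. if N \<omega> \<le> x then N \<omega> powr p else 0) \<le> K * (x powr p * tail M N x)"
proof -
  let ?F = "tail M N"
  define J where "J x = expectation (\<lambda>\<omega>. if N \<omega> \<le> x then N \<omega> powr p else 0)" for x
  \<comment> \<open>The gap above \<beta> turns the limit of the tail ratio at 2 into a bound valid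
    for all large x; the gap below p provides geometric growth.\<close>
  define q where "q = (\<beta> + p) / 2"
  have q: "\<beta> < q" "q < p" using p by (auto simp: q_def)
  have "2 powr (-q) < 2 powr (-\<beta>)" using q by (intro powr_less_mono) auto
  hence "eventually (\<lambda>x. ?F (2 * x) / ?F x > 2 powr (-q)) at_top"
    using rv_ratio[OF rv, of 2] by (intro order_tendstoD(1)) auto
  hence "eventually (\<lambda>x. ?F (2 * x) / ?F x > 2 powr (-q) \<and> ?F x > 0 \<and> x > 0) at_top"
    by (intro eventually_conj rv_eventually_pos[OF rv] eventually_gt_at_top)
  then obtain x0 where x0: "\<And>x. x \<ge> x0 \<Longrightarrow> ?F (2 * x) / ?F x > 2 powr (-q) \<and> ?F x > 0 \<and> x > 0"
    unfolding eventually_at_top_linorder by blast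
  have x0_pos: "x0 > 0" using x0[of x0] by simp
  have F2: "?F x \<le> 2 powr q * ?F (2 * x)" if "x \<ge> x0" for x
  proof -
    have "?F x > 0" "?F (2 * x) / ?F x > 2 powr (-q)" using x0[OF that] by auto
    thus ?thesis by (simp add: powr_minus field_simps)
  qed
  have int: "integrable M (\<lambda>\<omega>. if N \<omega> \<le> x then N \<omega> powr p else 0)" if "x \<ge> 0" for x
  proof (rule integrable_const_bound[where B = "x powr p"])
    show "AE \<omega> in M. norm (if N \<omega> \<le> x then N \<omega> powr p else 0) \<le> x powr p"
      using nonneg p by (intro AE_I2) (auto intro: powr_mono2)
  qed measurable
  \<comment> \<open>Doubling \<open>x\<close> multiplies the claimed bound by at least \<open>2 powr (p - q) > 1\<close>, which absorbs the additive term.\<close>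
  have J_double: "J (2 * x) \<le> J x + 2 powr p * x powr p * ?F x" if x: "x > 0" for x
  proof -
    have "J (2 * x) \<le> expectation (\<lambda>\<omega>. (if N \<omega> \<le> x then N \<omega> powr p else 0)
                        + (2 * x) powr p * indicator {\<omega>\<in>space M. N \<omega> > x} \<omega>)"
      unfolding J_def
    proof (intro integral_mono int Bochner_Integration.integrable_add integrable_mult_right)
      fix \<omega> assume \<omega>: "\<omega> \<in> space M"
      show "(if N \<omega> \<le> 2 * x then N \<omega> powr p else 0) \<le> (if N \<omega> \<le> x then N \<omega> powr p else 0)
               + (2 * x) powr p * indicator {\<omega>\<in>space M. N \<omega> > x} \<omega>"
        using nonneg[OF \<omega>] p \<omega> x by (auto simp: indicator_def intro: powr_mono2)
    next
      show "integrable M (indicator {\<omega>\<in>space M. N \<omega> > x} :: 'a \<Rightarrow> real)"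
        by (rule integrable_real_indicator) (auto simp: emeasure_eq_measure)
    qed (use x in auto)
    also have "\<dots> = J x + (2 * x) powr p * ?F x"
      unfolding J_def using x int[of x]
      by (subst Bochner_Integration.integral_add) (auto simp: tail_def emeasure_eq_measure intro!: integrable_mult_right)
    finally show ?thesis using x by (simp add: powr_mult)
  qed
  define \<theta> where "\<theta> = 2 powr (q - p)"
  have \<theta>: "\<theta> > 0" "\<theta> < 1" using q powr_less_mono[of "q - p" 0 2] by (auto simp: \<theta>_def)
  \<comment> \<open>The first entry covers \<open>x0 \<le> x \<le> 2 * x0\<close>, where the moment
    is at most \<open>(2 * x0) powr p\<close> and the tail at least \<open>?F (2 * x0)\<close>. The
    second is the fixed point of K \<mapsto> (K + 2^p) \<theta>; from there on, doubling does not
    enlarge the constant.\<close>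
  define K where "K = max (2 powr p / ?F (2 * x0)) (2 powr p * \<theta> / (1 - \<theta>))"
  have F2x0: "?F (2 * x0) > 0" using x0[of "2 * x0"] x0_pos by simp
  have K: "K \<ge> 2 powr p / ?F (2 * x0)" "(K + 2 powr p) * \<theta> \<le> K"
  proof -
    show "K \<ge> 2 powr p / ?F (2 * x0)" by (simp add: K_def)
    have "K \<ge> 2 powr p * \<theta> / (1 - \<theta>)" by (simp add: K_def)
    thus "(K + 2 powr p) * \<theta> \<le> K" using \<theta> by (simp add: field_simps)
  qed
  have "2 powr p * \<theta> / (1 - \<theta>) \<ge> 0" using \<theta> by (intro divide_nonneg_nonneg) auto
  hence K0: "K \<ge> 0" unfolding K_def by (rule max.coboundedI2)
  \<comment> \<open>n counts dyadic scales: n = 0 covers the interval from \<open>x0\<close> to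
    \<open>2 * x0\<close>, and the step halves x.\<close>
  have main: "x0 \<le> x \<Longrightarrow> x \<le> 2 ^ Suc n * x0 \<Longrightarrow> J x \<le> K * (x powr p * ?F x)" for x n
  proof (induction n arbitrary: x)
    case 0
    have "J x \<le> expectation (\<lambda>_. (2 * x0) powr p)"
      unfolding J_def
    proof (intro integral_mono int)
      fix \<omega> assume "\<omega> \<in> space M"
      thus "(if N \<omega> \<le> x then N \<omega> powr p else 0) \<le> (2 * x0) powr p"
        using nonneg[of \<omega>] 0 p by (auto intro: powr_mono2)
    qed (use 0 x0_pos in auto)
    also have "\<dots> = 2 powr p / ?F (2 * x0) * (x0 powr p * ?F (2 * x0))"
      using F2x0 x0_pos by (simp add: prob_space powr_mult)
    also have "\<dots> \<le> K * (x powr p * ?F x)"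
      using K(1) K0 0 x0_pos p by (intro mult_mono powr_mono2 tail_antimono) auto
    finally show ?case .
  next
    case (Suc n)
    show ?case
    proof (cases "x \<le> 2 * x0")
      case True
      have "(2::real) * 1 \<le> 2 * 2 ^ n" by (intro mult_left_mono) auto
      hence "2 * x0 \<le> 2 ^ Suc n * x0" using x0_pos by (intro mult_right_mono) auto
      thus ?thesis using Suc True by (intro Suc.IH) auto
    next
      case False
      define y where "y = x / 2"
      have y: "y \<ge> x0" "y > 0" "x = 2 * y" "y \<le> 2 ^ Suc n * x0"
        using False Suc.prems x0_pos by (auto simp: y_def)
      have "J x \<le> K * (y powr p * ?F y) + 2 powr p * y powr p * ?F y"
        using J_double[OF y(2)] Suc.IH[OF y(1) y(4)] y(3) by simp
      also have "\<dots> = (K + 2 powr p) * y powr p * ?F y" by (simp add: algebra_simps)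
      also have "\<dots> \<le> (K + 2 powr p) * y powr p * (2 powr q * ?F (2 * y))"
        using K0 by (intro mult_left_mono F2 y) auto
      also have "\<dots> = (K + 2 powr p) * \<theta> * ((2 * y) powr p * ?F (2 * y))"
        using y by (simp add: \<theta>_def powr_diff powr_mult)
      also have "\<dots> \<le> K * (x powr p * ?F x)"
        unfolding y(3) using K(2) by (intro mult_right_mono) auto
      finally show ?thesis .
    qed
  qed
  show ?thesis
  proof (rule that[OF K0 x0_pos])
    fix x assume x: "x \<ge> x0"
    obtain n where "x / x0 < 2 ^ n" using real_arch_pow[of 2 "x / x0"] by auto
    hence "x < 2 ^ n * x0" using x0_pos by (simp add: field_simps)
    also have "\<dots> \<le> 2 ^ Suc n * x0" using x0_pos by simp
    finally show "expectation (\<lambda>\<omega>. if N \<omega> \<le> x then N \<omega> powr p else 0) \<le> K * (x powr p * ?F x)"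
      using main[OF x, of n] by (simp add: J_def)
  qed
qed

text \<open>This replaces conditioning on \<open>N\<close>: the event splits along the values of
  \<open>N\<close>, and product probabilities are required only for the pairs of events that occur.
  Bounding the finite partial sums before passing to the limit avoids exchanging a series with the
  integral.\<close>

lemma prob_random_index_le:
  fixes N :: "'a \<Rightarrow> nat" and A :: "nat \<Rightarrow> 'a set" and h :: "nat \<Rightarrow> real"
  assumes N [measurable]: "N \<in> measurable M (count_space UNIV)"
    and A: "\<And>k. A k \<in> sets M"
    and ind: "\<And>k. prob ({\<omega>\<in>space M. N \<omega> = k} \<inter> A k) = prob {\<omega>\<in>space M. N \<omega> = k} * prob (A k)"
    and h: "\<And>k. prob (A k) \<le> h k" "integrable M (\<lambda>\<omega>. h (N \<omega>))"
  shows "prob {\<omega>\<in>space M. \<omega> \<in> A (N \<omega>)} \<le> expectation (\<lambda>\<omega>. h (N \<omega>))"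
proof -
  let ?B = "\<lambda>k. {\<omega>\<in>space M. N \<omega> = k} \<inter> A k"
  have [measurable]: "?B k \<in> sets M" for k using A by measurable
  have h0: "h k \<ge> 0" for k using h(1)[of k] measure_nonneg[of M "A k"] by linarith
  have "(\<lambda>k. prob (?B k)) sums prob (\<Union>k. ?B k)"
    by (intro finite_measure_UNION) (auto simp: disjoint_family_on_def)
  moreover have "(\<Union>k. ?B k) = {\<omega>\<in>space M. \<omega> \<in> A (N \<omega>)}" by auto
  ultimately have "(\<lambda>n. \<Sum>k<n. prob (?B k)) \<longlonglongrightarrow> prob {\<omega>\<in>space M. \<omega> \<in> A (N \<omega>)}"
    by (simp add: sums_def)
  thus ?thesis
  proof (rule LIMSEQ_le_const2, intro exI allI impI)
    fix n :: nat
    have int: "integrable M (\<lambda>\<omega>. h k * indicator {\<omega>\<in>space M. N \<omega> = k} \<omega>)" for k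
      by (intro integrable_mult_right integrable_real_indicator) (auto simp: emeasure_eq_measure)
    have "(\<Sum>k<n. prob (?B k)) \<le> (\<Sum>k<n. h k * prob {\<omega>\<in>space M. N \<omega> = k})"
      unfolding ind by (intro sum_mono) (auto simp: mult.commute intro!: mult_right_mono h)
    also have "\<dots> = expectation (\<lambda>\<omega>. \<Sum>k<n. h k * indicator {\<omega>\<in>space M. N \<omega> = k} \<omega>)"
      using int by (subst Bochner_Integration.integral_sum) auto
    also have "\<dots> \<le> expectation (\<lambda>\<omega>. h (N \<omega>))"
    proof (intro integral_mono h Bochner_Integration.integrable_sum int)
      fix \<omega> assume "\<omega> \<in> space M"
      hence "(\<Sum>k<n. h k * indicator {\<omega>\<in>space M. N \<omega> = k} \<omega>) = (\<Sum>k<n. if k = N \<omega> then h k else 0)"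
        by (intro sum.cong) (auto simp: indicator_def)
      also have "\<dots> \<le> h (N \<omega>)" using h0 by (simp add: sum.delta)
      finally show "(\<Sum>k<n. h k * indicator {\<omega>\<in>space M. N \<omega> = k} \<omega>) \<le> h (N \<omega>)" .
    qed
    finally show "(\<Sum>k<n. prob (?B k)) \<le> expectation (\<lambda>\<omega>. h (N \<omega>))" .
  qed
qed

subsection \<open>Sums with a random number of terms\<close>

text \<open>Storing the count at index 0 and the summands at the indices from 1 on lets one
  independence hypothesis say that the count is independent of all summands jointly.\<close>

lemma random_sum_deviation:
  fixes G :: "nat \<Rightarrow> 'a \<Rightarrow> real" and N :: "'a \<Rightarrow> nat" and \<beta> r B \<delta> :: real
  assumes ind: "indep_vars (\<lambda>_. borel) G UNIV" and G0: "G 0 = (\<lambda>\<omega>. real (N \<omega>))"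
    and N [measurable]: "N \<in> measurable M (count_space UNIV)"
    and rv: "rv (tail M (\<lambda>\<omega>. real (N \<omega>))) \<beta>" and r: "r > 1" "r > \<beta>"
    and int: "\<And>i. i \<ge> 1 \<Longrightarrow> integrable M (\<lambda>\<omega>. \<bar>G i \<omega>\<bar> powr r)"
    and B: "\<And>i. i \<ge> 1 \<Longrightarrow> expectation (\<lambda>\<omega>. \<bar>G i \<omega>\<bar> powr r) \<le> B"
    and mean: "\<And>i. i \<ge> 1 \<Longrightarrow> expectation (G i) = 0" and \<delta>: "\<delta> > 0"
  shows "(\<lambda>x. prob {\<omega>\<in>space M. \<bar>\<Sum>i=1..N \<omega>. G i \<omega>\<bar> > \<delta> * (x + real (N \<omega>))})
           \<in> o(tail M (\<lambda>\<omega>. real (N \<omega>)))"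
proof -
  let ?F = "tail M (\<lambda>\<omega>. real (N \<omega>))"
  define P where "P x = prob {\<omega>\<in>space M. \<bar>\<Sum>i=1..N \<omega>. G i \<omega>\<bar> > \<delta> * (x + real (N \<omega>))}" for x
  define S where "S k \<omega> = (\<Sum>i=1..k. G i \<omega>)" for k \<omega>
  have [measurable]: "G i \<in> borel_measurable M" for i
    using ind by (auto simp: indep_vars_def)
  have [measurable]: "S k \<in> borel_measurable M" for k
    unfolding S_def by measurable
  define \<rho> where "\<rho> = r - min r 2 + 1"
  \<comment> \<open>Strictly above \<beta> for the truncated moment bound, above \<rho> to dominate
    N^\<rho>, and strictly below r so that x^(p-r) tends to 0.\<close>
  define p where "p = (max \<rho> \<beta> + r) / 2"
  have \<rho>: "\<rho> \<ge> 1" "\<rho> < r" using r by (auto simp: \<rho>_def)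
  have p: "\<rho> < p" "\<beta> < p" "p < r" "0 < p" using \<rho> r by (auto simp: p_def max_def)
  have "indep_vars (\<lambda>_. borel) G {1..}" by (rule indep_vars_subset[OF ind]) auto
  from moment_partial_sum_le[OF this r(1) int B mean]
  obtain C where C: "C \<ge> 0" "\<And>k. integrable M (\<lambda>\<omega>. \<bar>S k \<omega>\<bar> powr r)"
    "\<And>k. expectation (\<lambda>\<omega>. \<bar>S k \<omega>\<bar> powr r) \<le> C * real k powr \<rho>"
    unfolding S_def \<rho>_def by blast
  obtain K x0 where K: "K \<ge> 0" "x0 > 0"
    "\<And>x. x \<ge> x0 \<Longrightarrow> expectation (\<lambda>\<omega>. if real (N \<omega>) \<le> x then real (N \<omega>) powr p else 0) \<le> K * (x powr p * ?F x)"
    using truncated_moment_le_tail[OF _ _ rv p(2,4)] by (auto simp: measurable_compose[OF N])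
  define c where "c = C / \<delta> powr r"
  have c: "c \<ge> 0" using C by (simp add: c_def)
  have bound: "P x \<le> c * (K + 1) * (x powr (p - r) * ?F x)" if x: "x \<ge> 1" "x \<ge> x0" for x
  proof -
    define h where "h k = c * (real k powr \<rho> / (x + real k) powr r)" for k
    define A where "A k = {\<omega>\<in>space M. \<bar>S k \<omega>\<bar> > \<delta> * (x + real k)}" for k
    have A [measurable]: "A k \<in> sets M" for k unfolding A_def by measurable
    have indA: "prob ({\<omega>\<in>space M. N \<omega> = k} \<inter> A k) = prob {\<omega>\<in>space M. N \<omega> = k} * prob (A k)" for k
    proof -
      have "indep_var borel (G 0) borel (S k)"
        unfolding S_def by (rule indep_vars_sum) (auto intro!: indep_vars_subset[OF ind])
      moreover have "{s::real. \<bar>s\<bar> > \<delta> * (x + real k)} \<in> sets borel" by measurable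
      ultimately have "prob ((\<lambda>\<omega>. (G 0 \<omega>, S k \<omega>)) -` ({real k} \<times> {s. \<bar>s\<bar> > \<delta> * (x + real k)}) \<inter> space M) =
          prob (G 0 -` {real k} \<inter> space M) * prob (S k -` {s. \<bar>s\<bar> > \<delta> * (x + real k)} \<inter> space M)"
        by (intro indep_varD) auto
      also have "(\<lambda>\<omega>. (G 0 \<omega>, S k \<omega>)) -` ({real k} \<times> {s. \<bar>s\<bar> > \<delta> * (x + real k)}) \<inter> space M =
          {\<omega>\<in>space M. N \<omega> = k} \<inter> A k" by (auto simp: G0 A_def)
      also have "G 0 -` {real k} \<inter> space M = {\<omega>\<in>space M. N \<omega> = k}" by (auto simp: G0)
      also have "S k -` {s. \<bar>s\<bar> > \<delta> * (x + real k)} \<inter> space M = A k" by (auto simp: A_def)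
      finally show ?thesis .
    qed
    have h: "prob (A k) \<le> h k" for k
    proof -
      let ?a = "\<delta> * (x + real k)"
      have a: "?a > 0" using \<delta> x by simp
      have "prob (A k) \<le> prob {\<omega>\<in>space M. \<bar>S k \<omega>\<bar> powr r \<ge> ?a powr r}"
        unfolding A_def using a r by (intro finite_measure_mono) (auto intro!: powr_mono2)
      also have "\<dots> \<le> expectation (\<lambda>\<omega>. \<bar>S k \<omega>\<bar> powr r) / ?a powr r"
        using a by (intro integral_Markov_inequality_measure[where A = "{}"] C) auto
      also have "\<dots> \<le> C * real k powr \<rho> / ?a powr r"
        by (intro divide_right_mono C) auto
      also have "\<dots> = h k" using \<delta> x by (simp add: h_def c_def powr_mult)
      finally show ?thesis .
    qed
    \<comment> \<open>Majorant of the Markov bound: for N \<le> x the denominator is at least x^r,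
      while for N > x it is at least N^r, leaving N^(p-r) \<le> x^(p-r).\<close>
    define g where "g \<omega> = c * (x powr (-r) * (if real (N \<omega>) \<le> x then real (N \<omega>) powr p else 0) +
       x powr (p - r) * indicator {\<omega>\<in>space M. real (N \<omega>) > x} \<omega>)" for \<omega>
    have hg: "h (N \<omega>) \<le> g \<omega>" if \<omega>: "\<omega> \<in> space M" for \<omega>
    proof -
      define y where "y = real (N \<omega>)"
      have "y powr \<rho> / (x + y) powr r \<le> x powr (-r) * (if y \<le> x then y powr p else 0) +
              x powr (p - r) * (if y > x then 1 else 0)"
      proof (cases "y \<le> x")
        case True
        \<comment> \<open>Raising the exponent is legitimate because y is a natural number, hence 0
          or at least 1.\<close>
        have "y powr \<rho> \<le> y powr p"
          using p by (cases "N \<omega>") (auto simp: y_def intro!: powr_mono)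
        moreover have "x powr r \<le> (x + y) powr r" using x r by (intro powr_mono2) (auto simp: y_def)
        ultimately have "y powr \<rho> / (x + y) powr r \<le> y powr p / x powr r"
          using x by (intro frac_le) auto
        thus ?thesis using True by (simp add: powr_minus field_simps)
      next
        case False
        have "y powr \<rho> \<le> y powr p" using False x p by (intro powr_mono) auto
        moreover have "y powr r \<le> (x + y) powr r" using x r by (intro powr_mono2) (auto simp: y_def)
        ultimately have "y powr \<rho> / (x + y) powr r \<le> y powr p / y powr r"
          using x False by (intro frac_le) auto
        also have "\<dots> = y powr (p - r)" by (simp add: powr_diff)
        also have "\<dots> \<le> x powr (p - r)" using x False p by (intro powr_mono2') auto
        finally show ?thesis using False by simp
      qed
      thus ?thesis unfolding h_def g_def using \<omega> c
        by (intro mult_left_mono) (auto simp: y_def indicator_def)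
    qed
    have int1: "integrable M (\<lambda>\<omega>. if real (N \<omega>) \<le> x then real (N \<omega>) powr p else 0)"
    proof (rule integrable_const_bound[where B = "x powr p"])
      show "AE \<omega> in M. norm (if real (N \<omega>) \<le> x then real (N \<omega>) powr p else 0) \<le> x powr p"
        using p by (intro AE_I2) (auto intro: powr_mono2)
    qed measurable
    have int2: "integrable M (indicator {\<omega>\<in>space M. real (N \<omega>) > x} :: 'a \<Rightarrow> real)"
      by (rule integrable_real_indicator) (auto simp: emeasure_eq_measure)
    have intg: "integrable M g"
      unfolding g_def using int1 int2
      by (intro integrable_mult_right Bochner_Integration.integrable_add) auto
    have h0: "h k \<ge> 0" for k using c by (simp add: h_def)
    have [measurable]: "(\<lambda>\<omega>. h (N \<omega>)) \<in> borel_measurable M"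
      by (rule measurable_compose[OF N]) simp
    have inth: "integrable M (\<lambda>\<omega>. h (N \<omega>))"
      by (rule Bochner_Integration.integrable_bound[OF intg])
         (use hg h0 in \<open>auto intro!: AE_I2 order_trans[OF _ abs_ge_self]\<close>)
    have "P x = prob {\<omega>\<in>space M. \<omega> \<in> A (N \<omega>)}"
      unfolding P_def A_def S_def by (intro arg_cong[where f = prob]) auto
    also have "\<dots> \<le> expectation (\<lambda>\<omega>. h (N \<omega>))"
      by (intro prob_random_index_le N A indA h inth)
    also have "\<dots> \<le> expectation g" by (intro integral_mono inth intg hg)
    also have "\<dots> = c * (x powr (-r) * expectation (\<lambda>\<omega>. if real (N \<omega>) \<le> x then real (N \<omega>) powr p else 0)
        + x powr (p - r) * ?F x)"
      unfolding g_def using int1 int2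
      by (simp add: Bochner_Integration.integral_add[OF integrable_mult_right integrable_mult_right] tail_def)
    also have "\<dots> \<le> c * (x powr (-r) * (K * (x powr p * ?F x)) + x powr (p - r) * ?F x)"
      using c x by (intro mult_left_mono add_mono K) auto
    also have "\<dots> = c * (K + 1) * (x powr (p - r) * ?F x)"
      using x by (simp add: powr_diff powr_minus field_simps)
    finally show ?thesis .
  qed
  have "P \<in> O(\<lambda>x. x powr (p - r) * ?F x)"
  proof (rule bigoI)
    show "\<forall>\<^sub>F x in at_top. norm (P x) \<le> (c * (K + 1)) * norm (x powr (p - r) * ?F x)"
      using eventually_ge_at_top[of 1] eventually_ge_at_top[of x0]
      by eventually_elim (use bound in \<open>auto simp: P_def abs_mult\<close>)
  qed
  also have "(\<lambda>x. x powr (p - r) * ?F x) \<in> o(\<lambda>x. 1 * ?F x)"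
  proof (rule landau_o.small_big_mult)
    have "((\<lambda>x. x powr (p - r)) \<longlongrightarrow> 0) at_top"
      using p by (intro tendsto_neg_powr filterlim_ident) auto
    thus "(\<lambda>x. x powr (p - r)) \<in> o(\<lambda>_. 1)" by (auto intro!: smalloI_tendsto)
  qed auto
  finally show ?thesis by (simp add: P_def[abs_def])
qed

text \<open>Outside the deviation event, U > x and L > x imply each other up to a fixed rescaling of
  x, which is the slack that \<open>rv_sandwich\<close> tolerates.\<close>

lemma relative_deviation_asymp:
  fixes U L :: "'a \<Rightarrow> real"
  assumes [measurable]: "U \<in> borel_measurable M" "L \<in> borel_measurable M"
    and rv: "rv (tail M L) \<beta>"
    and dev: "\<And>\<delta>. \<delta> > 0 \<Longrightarrow> (\<lambda>x. prob {\<omega>\<in>space M. \<bar>U \<omega> - L \<omega>\<bar> > \<delta> * (x + L \<omega>)}) \<in> o(tail M L)"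
  shows "tail M U \<sim>[at_top] tail M L"
proof (rule rv_sandwich[OF rv])
  fix \<eta> :: real assume \<eta>: "\<eta> > 1"
  \<comment> \<open>The solution of (1 + \<delta>)/(1 - \<delta>) = \<eta>, so that the same
    \<delta> serves the upper and the lower bound.\<close>
  define \<delta> where "\<delta> = (\<eta> - 1) / (\<eta> + 1)"
  have \<delta>: "\<delta> > 0" "\<delta> < 1" "1 + \<delta> = \<eta> * (1 - \<delta>)" using \<eta> by (auto simp: \<delta>_def field_simps)
  let ?D = "\<lambda>x. {\<omega>\<in>space M. \<bar>U \<omega> - L \<omega>\<bar> > \<delta> * (x + L \<omega>)}"
  show "\<exists>E. E \<in> o(tail M L) \<and> (\<forall>\<^sub>F x in at_top. tail M U x \<le> tail M L (inverse \<eta> * x) + E x)"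
  proof (intro exI conjI always_eventually allI)
    fix x
    have "tail M U x \<le> prob ({\<omega>\<in>space M. L \<omega> > inverse \<eta> * x} \<union> ?D x)"
      unfolding tail_def
    proof (intro finite_measure_mono subsetI)
      fix \<omega> assume "\<omega> \<in> {\<omega>\<in>space M. U \<omega> > x}"
      hence \<omega>: "\<omega> \<in> space M" "U \<omega> > x" by auto
      show "\<omega> \<in> {\<omega>\<in>space M. L \<omega> > inverse \<eta> * x} \<union> ?D x"
      proof (cases "\<omega> \<in> ?D x")
        case False
        hence "x < L \<omega> + \<delta> * (x + L \<omega>)" using \<omega> by auto
        hence "x * (1 - \<delta>) < L \<omega> * (1 + \<delta>)" by (simp add: algebra_simps)
        hence "x < L \<omega> * \<eta>" unfolding \<delta>(3) using \<delta>(2) by (simp flip: mult.assoc)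
        thus ?thesis using \<omega> \<eta> by (simp add: field_simps)
      qed auto
    qed measurable
    also have "\<dots> \<le> tail M L (inverse \<eta> * x) + prob (?D x)"
      unfolding tail_def by (rule measure_Un_le) measurable
    finally show "tail M U x \<le> tail M L (inverse \<eta> * x) + prob (?D x)" .
  qed (use dev[OF \<delta>(1)] in auto)
  show "\<exists>E. E \<in> o(tail M L) \<and> (\<forall>\<^sub>F x in at_top. tail M U x \<ge> tail M L (\<eta> * x) - E x)"
  proof (intro exI conjI always_eventually allI)
    fix x
    have "tail M L (\<eta> * x) \<le> prob ({\<omega>\<in>space M. U \<omega> > x} \<union> ?D x)"
      unfolding tail_def
    proof (intro finite_measure_mono subsetI)
      fix \<omega> assume "\<omega> \<in> {\<omega>\<in>space M. L \<omega> > \<eta> * x}"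
      hence \<omega>: "\<omega> \<in> space M" "L \<omega> > \<eta> * x" by auto
      show "\<omega> \<in> {\<omega>\<in>space M. U \<omega> > x} \<union> ?D x"
      proof (cases "\<omega> \<in> ?D x")
        case False
        hence "U \<omega> \<ge> L \<omega> - \<delta> * (x + L \<omega>)" using \<omega> by auto
        moreover have "(1 - \<delta>) * (\<eta> * x) < (1 - \<delta>) * L \<omega>" using \<omega> \<delta> by simp
        moreover have "(1 - \<delta>) * (\<eta> * x) = (1 + \<delta>) * x" unfolding \<delta>(3) by simp
        ultimately have "U \<omega> > x" by (simp add: algebra_simps)
        thus ?thesis using \<omega> by simp
      qed auto
    qed measurable
    also have "\<dots> \<le> tail M U x + prob (?D x)"
      unfolding tail_def by (rule measure_Un_le) measurable
    finally show "tail M U x \<ge> tail M L (\<eta> * x) - prob (?D x)" by simp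
  qed (use dev[OF \<delta>(1)] in auto)
qed

lemma integrable_nat_powr:
  fixes Z :: "'a \<Rightarrow> nat"
  assumes [measurable]: "Z \<in> measurable M (count_space UNIV)" and r: "r \<ge> 1"
    and int: "integrable M (\<lambda>\<omega>. real (Z \<omega>) powr r)"
  shows "integrable M (\<lambda>\<omega>. real (Z \<omega>))"
    and "integrable M (\<lambda>\<omega>. \<bar>real (Z \<omega>) - m\<bar> powr r)"
proof -
  have meas: "(\<lambda>\<omega>. real (Z \<omega>)) \<in> borel_measurable M" by measurable
  show "integrable M (\<lambda>\<omega>. real (Z \<omega>))"
    using integrable_powr_le(1)[OF meas, of r 1] r int by simp
  have le: "\<bar>real k - m\<bar> powr r \<le> (2 * \<bar>m\<bar>) powr r + (2 * real k) powr r" for k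
  proof -
    have "\<bar>real k - m\<bar> powr r \<le> (2 * max (real k) \<bar>m\<bar>) powr r" using r by (intro powr_mono2) auto
    also have "\<dots> \<le> (2 * \<bar>m\<bar>) powr r + (2 * real k) powr r" by (simp add: max_def)
    finally show ?thesis .
  qed
  show "integrable M (\<lambda>\<omega>. \<bar>real (Z \<omega>) - m\<bar> powr r)"
  proof (rule Bochner_Integration.integrable_bound)
    show "integrable M (\<lambda>\<omega>. (2 * \<bar>m\<bar>) powr r + (2 * real (Z \<omega>)) powr r)"
      using int by (auto simp: powr_mult)
    show "AE \<omega> in M. norm (\<bar>real (Z \<omega>) - m\<bar> powr r)
        \<le> norm ((2 * \<bar>m\<bar>) powr r + (2 * real (Z \<omega>)) powr r)"
      using le by (intro AE_I2) (auto intro!: order_trans[OF _ abs_ge_self])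
  qed measurable
qed

text \<open>The transfer of the deviation estimate through one reproduction step. The error splits
  into the fluctuation of the centred offspring and m times the error already present in the parent
  count. \<open>L'\<close> stands for the next linear combination, of which m L is one part.\<close>

lemma random_sum_linear_deviation:
  fixes H :: "nat \<Rightarrow> 'a \<Rightarrow> nat" and L L' :: "'a \<Rightarrow> real" and Z :: "'a \<Rightarrow> nat" and \<beta> r m :: real
  assumes ind: "indep_vars (\<lambda>_. count_space UNIV) H UNIV"
    and Z [measurable]: "Z \<in> measurable M (count_space UNIV)"
    and id: "\<And>i. i \<ge> 1 \<Longrightarrow> distr M (count_space UNIV) (H i) = distr M (count_space UNIV) Z"
    and int: "integrable M (\<lambda>\<omega>. real (Z \<omega>) powr r)" and r: "r > 1" "r > \<beta>"
    and m: "m = expectation (\<lambda>\<omega>. real (Z \<omega>))"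
    and L [measurable]: "L \<in> borel_measurable M" and L': "L' \<in> borel_measurable M"
    and rvL: "rv (tail M L) \<beta>" and rvL': "rv (tail M L') \<beta>"
    and L0: "\<And>\<omega>. \<omega> \<in> space M \<Longrightarrow> L \<omega> \<ge> 0" and LL': "\<And>\<omega>. \<omega> \<in> space M \<Longrightarrow> m * L \<omega> \<le> L' \<omega>"
    and dev: "\<And>\<delta>. \<delta> > 0 \<Longrightarrow> (\<lambda>x. prob {\<omega>\<in>space M. \<bar>real (H 0 \<omega>) - L \<omega>\<bar> > \<delta> * (x + L \<omega>)}) \<in> o(tail M L)"
    and \<delta>: "\<delta> > 0"
  shows "(\<lambda>x. prob {\<omega>\<in>space M. \<bar>real (\<Sum>i=1..H 0 \<omega>. H i \<omega>) - m * L \<omega>\<bar> > \<delta> * (m * (x + L \<omega>))}) \<in> o(tail M L')"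
proof -
  have H [measurable]: "H i \<in> measurable M (count_space UNIV)" for i
    using ind by (auto simp: indep_vars_def)
  have transfer: "integrable M (\<lambda>\<omega>. f (H i \<omega>)) \<longleftrightarrow> integrable M (\<lambda>\<omega>. f (Z \<omega>))"
       "expectation (\<lambda>\<omega>. f (H i \<omega>)) = expectation (\<lambda>\<omega>. f (Z \<omega>))"
    if "i \<ge> 1" for i and f :: "nat \<Rightarrow> real"
  proof -
    have "integrable M (\<lambda>\<omega>. f (H i \<omega>)) \<longleftrightarrow> integrable (distr M (count_space UNIV) (H i)) f"
      by (subst integrable_distr_eq[OF H]) auto
    also have "\<dots> \<longleftrightarrow> integrable M (\<lambda>\<omega>. f (Z \<omega>))"
      unfolding id[OF that] by (subst integrable_distr_eq[OF Z]) auto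
    finally show "integrable M (\<lambda>\<omega>. f (H i \<omega>)) \<longleftrightarrow> integrable M (\<lambda>\<omega>. f (Z \<omega>))" .
    have "expectation (\<lambda>\<omega>. f (H i \<omega>)) = integral\<^sup>L (distr M (count_space UNIV) (H i)) f"
      by (subst integral_distr[OF H]) auto
    also have "\<dots> = expectation (\<lambda>\<omega>. f (Z \<omega>))"
      unfolding id[OF that] by (subst integral_distr[OF Z]) auto
    finally show "expectation (\<lambda>\<omega>. f (H i \<omega>)) = expectation (\<lambda>\<omega>. f (Z \<omega>))" .
  qed
  have intZ: "integrable M (\<lambda>\<omega>. real (Z \<omega>))"
    using integrable_nat_powr(1)[OF Z _ int] r by simp
  have "m \<ge> 0" unfolding m by simp
  have sum_meas [measurable]: "(\<lambda>\<omega>. \<Sum>i=1..H 0 \<omega>. real (H i \<omega>) - c) \<in> borel_measurable M" for c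
    by (rule measurable_compose_countable[OF _ H[of 0], where f = "\<lambda>k \<omega>. \<Sum>i=1..k. real (H i \<omega>) - c"]) measurable
  consider "m = 0" | "m > 0" using \<open>m \<ge> 0\<close> by fastforce
  thus ?thesis
  proof cases
    case 1
    \<comment> \<open>With m = 0 the tolerance is 0 and m L \<le> L' gives no comparison of tails,
      but offspring with mean 0 vanish almost surely, so the event is null.\<close>
    have "AE \<omega> in M. H i \<omega> = 0" if "i \<ge> 1" for i
    proof -
      have "integrable M (\<lambda>\<omega>. real (H i \<omega>))" using transfer(1)[OF that, of real] intZ by simp
      moreover have "expectation (\<lambda>\<omega>. real (H i \<omega>)) = 0" using transfer(2)[OF that, of real] 1 m by simp
      ultimately have "AE \<omega> in M. real (H i \<omega>) = 0"
        by (subst (asm) integral_nonneg_eq_0_iff_AE) auto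
      thus ?thesis by simp
    qed
    hence "AE \<omega> in M. \<forall>i. i \<ge> 1 \<longrightarrow> H i \<omega> = 0" by (auto simp: AE_all_countable)
    hence "AE \<omega> in M. \<not> (\<bar>real (\<Sum>i=1..H 0 \<omega>. H i \<omega>) - m * L \<omega>\<bar> > \<delta> * (m * (x + L \<omega>)))" for x
      by eventually_elim (auto simp: 1)
    hence "prob {\<omega>\<in>space M. \<bar>real (\<Sum>i=1..H 0 \<omega>. H i \<omega>) - m * L \<omega>\<bar> > \<delta> * (m * (x + L \<omega>))} = 0" for x
      by (rule prob_eq_0_AE)
    thus ?thesis by simp
  next
    case m_pos: 2
    define N where "N = H 0"
    have N [measurable]: "N \<in> measurable M (count_space UNIV)" by (simp add: N_def)
    define G where "G i \<omega> = (if i = 0 then real (H i \<omega>) else real (H i \<omega>) - m)" for i :: nat and \<omega>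
    have "indep_vars (\<lambda>_. borel) (\<lambda>i \<omega>. (\<lambda>k. if i = 0 then real k else real k - m) (H i \<omega>)) UNIV"
      by (rule indep_vars_compose2[OF ind]) simp
    hence indG: "indep_vars (\<lambda>_. borel) G UNIV" by (simp add: G_def[abs_def])
    \<comment> \<open>The deviation hypothesis is used twice: here, to make the tail of the parent
      count regularly varying, and later to bound the error inherited from the parents.\<close>
    have asympN: "tail M (\<lambda>\<omega>. real (N \<omega>)) \<sim>[at_top] tail M L"
      using dev by (intro relative_deviation_asymp[OF _ L rvL]) (auto simp: N_def)
    have rvN: "rv (tail M (\<lambda>\<omega>. real (N \<omega>))) \<beta>" by (rule rv_asymp_equiv[OF rvL asympN]) simp
    \<comment> \<open>With y = x + L, \<epsilon> \<le> 1 gives x + N \<le> 2y, so the fluctuation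
      costs 2 \<epsilon> m y and the inherited error \<epsilon> m y, in total 3 \<epsilon> m
      y.\<close>
    define \<epsilon> where "\<epsilon> = min 1 (\<delta> / 3)"
    have \<epsilon>: "\<epsilon> > 0" "\<epsilon> \<le> 1" "3 * \<epsilon> \<le> \<delta>" using \<delta> by (auto simp: \<epsilon>_def)
    let ?S = "\<lambda>\<omega>. \<Sum>i=1..N \<omega>. real (H i \<omega>) - m"
    let ?A = "\<lambda>x. {\<omega>\<in>space M. \<bar>?S \<omega>\<bar> > \<epsilon> * m * (x + real (N \<omega>))}"
    let ?D = "\<lambda>x. {\<omega>\<in>space M. \<bar>real (N \<omega>) - L \<omega>\<bar> > \<epsilon> * (x + L \<omega>)}"
    let ?R = "\<lambda>x. {\<omega>\<in>space M. \<bar>real (\<Sum>i=1..N \<omega>. H i \<omega>) - m * L \<omega>\<bar> > \<delta> * (m * (x + L \<omega>))}"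
    have "(\<lambda>x. prob {\<omega>\<in>space M. \<bar>\<Sum>i=1..N \<omega>. G i \<omega>\<bar> > \<epsilon> * m * (x + real (N \<omega>))}) \<in> o(tail M (\<lambda>\<omega>. real (N \<omega>)))"
    proof (rule random_sum_deviation[OF indG _ N rvN r])
      fix i :: nat assume i: "i \<ge> 1"
      show "integrable M (\<lambda>\<omega>. \<bar>G i \<omega>\<bar> powr r)"
        using transfer(1)[OF i, of "\<lambda>k. \<bar>real k - m\<bar> powr r"] integrable_nat_powr(2)[OF Z _ int] r i
        by (simp add: G_def)
      show "expectation (\<lambda>\<omega>. \<bar>G i \<omega>\<bar> powr r) \<le> expectation (\<lambda>\<omega>. \<bar>real (Z \<omega>) - m\<bar> powr r)"
        using transfer(2)[OF i, of "\<lambda>k. \<bar>real k - m\<bar> powr r"] i by (simp add: G_def)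
      show "expectation (G i) = 0"
        using transfer(2)[OF i, of "\<lambda>k. real k - m"] i intZ by (simp add: G_def[abs_def] m prob_space)
    qed (use \<epsilon> m_pos in \<open>auto simp: G_def[abs_def] N_def\<close>)
    also have "(\<lambda>x. prob {\<omega>\<in>space M. \<bar>\<Sum>i=1..N \<omega>. G i \<omega>\<bar> > \<epsilon> * m * (x + real (N \<omega>))}) = (\<lambda>x. prob (?A x))"
      by (intro ext arg_cong[where f = prob] Collect_cong conj_cong refl) (auto simp: G_def intro!: sum.cong)
    finally have A: "(\<lambda>x. prob (?A x)) \<in> o(tail M (\<lambda>\<omega>. real (N \<omega>)))" .
    have "(\<lambda>x. prob (?A x)) \<in> o(tail M L)"
      by (rule landau_o.small_big_trans[OF A asymp_equiv_imp_bigo[OF asympN]])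
    moreover have "(\<lambda>x. prob (?D x)) \<in> o(tail M L)" using dev[OF \<epsilon>(1)] by (simp add: N_def)
    ultimately have AD: "(\<lambda>x. prob (?A x) + prob (?D x)) \<in> o(tail M L)" by (rule sum_in_smallo)
    \<comment> \<open>Domination of m L by \<open>L'\<close> turns smallness relative to the tail of
      \<open>L\<close> into smallness relative to that of \<open>L'\<close>; m > 0 is what makes the
      rescaling harmless.\<close>
    have "tail M L \<in> O(\<lambda>x. tail M L' (m * x))"
    proof (intro bigoI[of _ 1] always_eventually allI)
      fix x
      have "tail M L x \<le> tail M L' (m * x)"
      proof (intro tail_mono L L')
        fix \<omega> assume "\<omega> \<in> space M" "L \<omega> > x"
        moreover from this have "m * x < m * L \<omega>" using m_pos by simp
        ultimately show "L' \<omega> > m * x" using LL'[of \<omega>] by linarith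
      qed
      thus "norm (tail M L x) \<le> 1 * norm (tail M L' (m * x))" by simp
    qed
    also have "(\<lambda>x. tail M L' (m * x)) \<in> O(tail M L')" by (rule rv_scale_bigo[OF rvL' m_pos])
    finally have "tail M L \<in> O(tail M L')" .
    with AD have AD': "(\<lambda>x. prob (?A x) + prob (?D x)) \<in> o(tail M L')"
      by (rule landau_o.small_big_trans)
    have [measurable]: "?S \<in> borel_measurable M" using sum_meas[of m] by (simp add: N_def)
    have "(\<lambda>x. prob (?R x)) \<in> O(\<lambda>x. prob (?A x) + prob (?D x))"
    proof (rule bigoI[of _ 1])
      show "\<forall>\<^sub>F x in at_top. norm (prob (?R x)) \<le> 1 * norm (prob (?A x) + prob (?D x))"
        using eventually_ge_at_top[of 0]
      proof eventually_elim
        case (elim x)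
        have "prob (?R x) \<le> prob (?A x \<union> ?D x)"
        proof (intro finite_measure_mono subsetI)
          fix \<omega> assume "\<omega> \<in> ?R x"
          hence \<omega>: "\<omega> \<in> space M" and R: "\<bar>real (\<Sum>i=1..N \<omega>. H i \<omega>) - m * L \<omega>\<bar> > \<delta> * (m * (x + L \<omega>))" by auto
          show "\<omega> \<in> ?A x \<union> ?D x"
          proof (rule ccontr)
            assume "\<omega> \<notin> ?A x \<union> ?D x"
            hence a: "\<bar>?S \<omega>\<bar> \<le> \<epsilon> * m * (x + real (N \<omega>))" and d: "\<bar>real (N \<omega>) - L \<omega>\<bar> \<le> \<epsilon> * (x + L \<omega>)"
              using \<omega> by auto
            define y where "y = x + L \<omega>"
            have y: "y \<ge> 0" using elim L0[OF \<omega>] by (simp add: y_def)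
            have "\<epsilon> * y \<le> 1 * y" using \<epsilon> y by (intro mult_right_mono) auto
            moreover have "real (N \<omega>) - L \<omega> \<le> \<epsilon> * y" using d by (simp add: y_def)
            ultimately have N2: "x + real (N \<omega>) \<le> 2 * y" by (simp add: y_def)
            have "real (\<Sum>i=1..N \<omega>. H i \<omega>) - m * L \<omega> = ?S \<omega> + m * (real (N \<omega>) - L \<omega>)"
              by (simp add: sum_subtractf algebra_simps)
            also have "\<bar>\<dots>\<bar> \<le> \<bar>?S \<omega>\<bar> + m * \<bar>real (N \<omega>) - L \<omega>\<bar>"
              using abs_triangle_ineq[of "?S \<omega>" "m * (real (N \<omega>) - L \<omega>)"] m_pos by (simp add: abs_mult)
            also have "\<dots> \<le> \<epsilon> * m * (2 * y) + m * (\<epsilon> * y)"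
            proof (rule add_mono)
              have "\<epsilon> * m * (x + real (N \<omega>)) \<le> \<epsilon> * m * (2 * y)"
                using \<epsilon> m_pos by (intro mult_left_mono N2) auto
              thus "\<bar>?S \<omega>\<bar> \<le> \<epsilon> * m * (2 * y)" using a by linarith
            qed (use d m_pos in \<open>auto simp: y_def intro!: mult_left_mono\<close>)
            also have "\<dots> = (3 * \<epsilon>) * (m * y)" by (simp add: algebra_simps)
            also have "\<dots> \<le> \<delta> * (m * y)" using \<epsilon> m_pos y by (intro mult_right_mono) auto
            finally show False using R by (simp add: y_def)
          qed
        qed measurable
        also have "\<dots> \<le> prob (?A x) + prob (?D x)" by (rule measure_Un_le) measurable
        finally show ?case by simp
      qed
    qed
    from landau_o.big_small_trans[OF this AD'] show ?thesis by (simp add: N_def)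
  qed
qed

end

subsection \<open>Second-order Galton--Watson processes\<close>

text \<open>A Lucas sequence, shifted so that index k stands for m_(k-1) with m_(-1) = 0. In this
  form nonnegativity and the recursion are immediate, neither of which is visible in the quotient
  defining \<open>mseq\<close>.\<close>

fun gw_weight :: "real \<Rightarrow> real \<Rightarrow> nat \<Rightarrow> real" where
  "gw_weight a b 0 = 0"
| "gw_weight a b (Suc 0) = 1"
| "gw_weight a b (Suc (Suc k)) = a * gw_weight a b (Suc k) + b * gw_weight a b k"

lemma gw_weight_nonneg: "a \<ge> 0 \<Longrightarrow> b \<ge> 0 \<Longrightarrow> gw_weight a b k \<ge> 0"
  by (induction a b k rule: gw_weight.induct) auto

text \<open>Binet's formula: \<open>lam_plus\<close> and \<open>lam_minus\<close> are the roots of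
  z^2 = a z + b.\<close>

lemma mseq_eq_gw_weight:
  assumes "a \<ge> 0" "b \<ge> 0"
  shows "mseq a b k = gw_weight a b (Suc k)"
proof -
  define p q where "p = lam_plus a b" and "q = lam_minus a b"
  define s where "s = sqrt (a\<^sup>2 + 4 * b)"
  have s2: "s * s = a\<^sup>2 + 4 * b" using assms by (simp add: s_def)
  have pq: "p = (a + s) / 2" "q = (a - s) / 2"
    by (auto simp: p_def q_def s_def lam_plus_def lam_minus_def)
  have sq: "p * p = a * p + b" "q * q = a * q + b"
    using s2 by (auto simp: pq field_simps power2_eq_square)
  show ?thesis
  proof (cases "s = 0")
    \<comment> \<open>Coinciding roots force a = b = 0. The quotient is then 0/0 = 0, which agrees
      with the recursion for k \<ge> 1, while \<open>mseq\<close> sets the value 1 at k = 0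
      explicitly.\<close>
    case True
    hence "a\<^sup>2 + 4 * b = 0" using assms by (simp add: s_def)
    moreover have "a\<^sup>2 \<ge> 0" by simp
    ultimately have b: "b = 0" and "a\<^sup>2 = 0" using assms by linarith+
    hence a: "a = 0" by simp
    show ?thesis
    proof (cases k)
      case (Suc l)
      thus ?thesis by (simp add: mseq_def a b lam_plus_def lam_minus_def)
    qed (simp add: mseq_def)
  next
    case False
    hence ne: "p - q \<noteq> 0" by (simp add: pq)
    have "gw_weight a b j = (p ^ j - q ^ j) / (p - q)" for j
    proof (induction j rule: induct_nat_012)
      case (ge2 j)
      have "p ^ Suc (Suc j) = (p * p) * p ^ j" "q ^ Suc (Suc j) = (q * q) * q ^ j" by simp_all
      hence "p ^ Suc (Suc j) - q ^ Suc (Suc j) = a * (p ^ Suc j - q ^ Suc j) + b * (p ^ j - q ^ j)"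
        unfolding sq by (simp add: algebra_simps)
      thus ?case using ge2 by (simp add: add_divide_distrib)
    qed (use ne in auto)
    thus ?thesis using ne by (auto simp: mseq_def p_def[symmetric] q_def[symmetric])
  qed
qed

text \<open>Indices are shifted by one so that they are natural numbers: \<open>gw_gen k\<close> corresponds to $X_{k-1}$.\<close>

fun gw_gen :: "nat \<Rightarrow> (gw_idx \<Rightarrow> nat) \<Rightarrow> nat" where
  "gw_gen 0 g = g IXm1"
| "gw_gen (Suc 0) g = g IX0"
| "gw_gen (Suc (Suc k)) g = (\<Sum>i=1..gw_gen (Suc k) g. g (Ixi (Suc k) i))
     + (\<Sum>j=1..gw_gen k g. g (Ieta (Suc k) j)) + g (Ieps (Suc k))"

text \<open>The coordinates that can influence \<open>gw_gen k\<close> for k \<le> l. The inequality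
  n < l is strict because of the index shift: the variables with first index n first enter
  \<open>gw_gen (Suc n)\<close>.\<close>

definition gw_past :: "nat \<Rightarrow> gw_idx set" where
  "gw_past l = {IX0, IXm1} \<union> {Ixi n i |n i. 1 \<le> n \<and> n < l \<and> i \<ge> 1}
     \<union> {Ieta n j |n j. 1 \<le> n \<and> n < l \<and> j \<ge> 1} \<union> {Ieps n |n. 1 \<le> n \<and> n < l}"

lemma gw_past_subset: "gw_past l \<subseteq> gw_idxs"
  by (auto simp: gw_past_def gw_idxs_def)

lemma gw_gen_restrict: "k \<le> l \<Longrightarrow> gw_gen k (restrict g (gw_past l)) = gw_gen k g"
proof (induction k g rule: gw_gen.induct)
  case (3 k g)
  have "restrict g (gw_past l) (Ixi (Suc k) i) = g (Ixi (Suc k) i)"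
       "restrict g (gw_past l) (Ieta (Suc k) i) = g (Ieta (Suc k) i)" if "i \<ge> 1" for i
    using 3(3) that by (auto simp: gw_past_def)
  moreover have "restrict g (gw_past l) (Ieps (Suc k)) = g (Ieps (Suc k))"
    using 3(3) by (auto simp: gw_past_def)
  ultimately show ?case using 3 by (auto intro!: arg_cong2[where f = "(+)"] sum.cong)
qed (auto simp: gw_past_def)

lemma measurable_add_nat:
  fixes f g :: "'a \<Rightarrow> nat"
  assumes [measurable]: "f \<in> measurable M (count_space UNIV)" "g \<in> measurable M (count_space UNIV)"
  shows "(\<lambda>x. f x + g x) \<in> measurable M (count_space UNIV)"
  by measurable

text \<open>The random upper limits take countably many values, so each sum is pieced together from
  sums of fixed length. Strong induction is used because two earlier generations enter.\<close>

lemma measurable_gw_gen: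
  "k \<le> l \<Longrightarrow> gw_gen k \<in> measurable (PiM (gw_past l) (\<lambda>_. count_space UNIV)) (count_space UNIV)"
proof (induction k arbitrary: l rule: less_induct)
  case (less k l)
  let ?P = "PiM (gw_past l) (\<lambda>_. count_space UNIV) :: (gw_idx \<Rightarrow> nat) measure"
  have comp: "(\<lambda>g. g i) \<in> measurable ?P (count_space UNIV)" if "i \<in> gw_past l" for i
    using measurable_component_singleton[OF that, of "\<lambda>_. count_space UNIV"] by simp
  consider "k = 0" | "k = Suc 0" | j where "k = Suc (Suc j)"
    by (metis not0_implies_Suc)
  thus ?case
  proof cases
    case 1
    thus ?thesis using comp[of IXm1] by (simp add: gw_past_def)
  next
    case 2
    thus ?thesis using comp[of IX0] by (simp add: gw_past_def)
  next
    case (3 j)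
    have IH: "gw_gen (Suc j) \<in> measurable ?P (count_space UNIV)" "gw_gen j \<in> measurable ?P (count_space UNIV)"
      using less 3 by auto
    have "(\<lambda>g. \<Sum>i=1..gw_gen (Suc j) g. g (Ixi (Suc j) i)) \<in> measurable ?P (count_space UNIV)"
      using less.prems 3
      by (intro measurable_compose_countable[OF _ IH(1), where f = "\<lambda>m g. \<Sum>i=1..m. g (Ixi (Suc j) i)"]
           measurable_sum_nat comp) (auto simp: gw_past_def)
    moreover have "(\<lambda>g. \<Sum>i=1..gw_gen j g. g (Ieta (Suc j) i)) \<in> measurable ?P (count_space UNIV)"
      using less.prems 3
      by (intro measurable_compose_countable[OF _ IH(2), where f = "\<lambda>m g. \<Sum>i=1..m. g (Ieta (Suc j) i)"]
           measurable_sum_nat comp) (auto simp: gw_past_def)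
    moreover have "(\<lambda>g. g (Ieps (Suc j))) \<in> measurable ?P (count_space UNIV)"
      using less.prems 3 by (intro comp) (auto simp: gw_past_def)
    ultimately show ?thesis unfolding 3 gw_gen.simps(3)[abs_def] by (intro measurable_add_nat)
  qed
qed

text \<open>Disjoint blocks of an independent family are independent: \<open>K\<close> is one block,
  every other index gets a single coordinate outside it. The result has the shape, count at index 0,
  that the random sum lemmas expect.\<close>

lemma (in prob_space) indep_vars_function_Cons:
  fixes V :: "'i \<Rightarrow> 'a \<Rightarrow> 'b" and f :: "('i \<Rightarrow> 'b) \<Rightarrow> 'b"
  assumes ind: "indep_vars (\<lambda>_. S) V I" and K: "K \<subseteq> I"
    and \<phi>: "inj_on \<phi> {1..}" "\<And>i. i \<ge> 1 \<Longrightarrow> \<phi> i \<in> I - K"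
    and f: "f \<in> measurable (PiM K (\<lambda>_. S)) S"
  shows "indep_vars (\<lambda>_. S) (\<lambda>i \<omega>. if i = 0 then f (restrict (\<lambda>j. V j \<omega>) K) else V (\<phi> i) \<omega>) (UNIV :: nat set)"
proof -
  define A where "A i = (if i = 0 then K else {\<phi> i})" for i :: nat
  define g where "g i = (if i = 0 then f else (\<lambda>h. h (\<phi> i)))" for i :: nat
  have sub: "A i \<subseteq> I" for i using K \<phi>(2) by (auto simp: A_def)
  have disj: "disjoint_family_on A UNIV"
    unfolding disjoint_family_on_def
  proof (intro ballI impI)
    fix i j :: nat assume "i \<noteq> j"
    thus "A i \<inter> A j = {}"
      using \<phi>(2)[of i] \<phi>(2)[of j] inj_onD[OF \<phi>(1), of i j] by (auto simp: A_def)
  qed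
  have "indep_vars (\<lambda>i. PiM (A i) (\<lambda>_. S)) (\<lambda>i \<omega>. restrict (\<lambda>j. V j \<omega>) (A i)) UNIV"
    by (rule indep_vars_restrict[OF ind sub disj])
  hence "indep_vars (\<lambda>_. S) (\<lambda>i \<omega>. g i (restrict (\<lambda>j. V j \<omega>) (A i))) UNIV"
    by (rule indep_vars_compose2) (auto simp: g_def A_def f intro!: measurable_component_singleton)
  also have "(\<lambda>i \<omega>. g i (restrict (\<lambda>j. V j \<omega>) (A i))) =
     (\<lambda>i \<omega>. if i = 0 then f (restrict (\<lambda>j. V j \<omega>) K) else V (\<phi> i) \<omega>)"
    by (auto simp: g_def A_def fun_eq_iff)
  finally show ?thesis .
qed

section \<open>The process and its linearisation\<close>

locale second_order_gw = prob_space M for M :: "'a measure" +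
  fixes V :: "gw_idx \<Rightarrow> 'a \<Rightarrow> nat" and \<beta> r :: real
  assumes indep: "indep_vars (\<lambda>_. count_space UNIV) V gw_idxs"
    and xi_id: "\<And>n i. n \<ge> 1 \<Longrightarrow> i \<ge> 1 \<Longrightarrow>
      distr M (count_space UNIV) (V (Ixi n i)) = distr M (count_space UNIV) (V (Ixi 1 1))"
    and eta_id: "\<And>n i. n \<ge> 1 \<Longrightarrow> i \<ge> 1 \<Longrightarrow>
      distr M (count_space UNIV) (V (Ieta n i)) = distr M (count_space UNIV) (V (Ieta 1 1))"
    and eps_id: "\<And>n. n \<ge> 1 \<Longrightarrow>
      distr M (count_space UNIV) (V (Ieps n)) = distr M (count_space UNIV) (V (Ieps 1))"
    and rv_X0: "rv (tail M (\<lambda>\<omega>. real (V IX0 \<omega>))) \<beta>"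
    and rv_Xm1: "rv (tail M (\<lambda>\<omega>. real (V IXm1 \<omega>))) \<beta>"
    and rv_eps1: "rv (tail M (\<lambda>\<omega>. real (V (Ieps 1) \<omega>))) \<beta>"
    and r: "r > 1" "r > \<beta>"
    and int_xi: "integrable M (\<lambda>\<omega>. real (V (Ixi 1 1) \<omega>) powr r)"
    and int_eta: "integrable M (\<lambda>\<omega>. real (V (Ieta 1 1) \<omega>) powr r)"
begin

definition mxi :: real where "mxi = expectation (\<lambda>\<omega>. real (V (Ixi 1 1) \<omega>))"
definition meta :: real where "meta = expectation (\<lambda>\<omega>. real (V (Ieta 1 1) \<omega>))"

definition U :: "nat \<Rightarrow> 'a \<Rightarrow> nat" where "U k \<omega> = gw_gen k (\<lambda>i. V i \<omega>)"

text \<open>\<open>L k\<close> is the linear combination of the initial values and immigrations that arises when every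
offspring variable in the recursion for \<open>U k\<close> is replaced by its mean.\<close>

definition sources :: "nat \<Rightarrow> gw_idx set" where
  "sources k = {IX0, IXm1} \<union> Ieps ` {1..<k}"

text \<open>A source that first appears with weight 1 at shifted time t has weight
  \<open>gw_weight\<close> at k - t + 1. For the initial value \<open>IXm1\<close> all influence on
  later generations passes through its \<open>eta\<close> children. Its case k = 0 is separate
  because the truncated k - 1 would give weight 0 instead of 1.\<close>

definition coef :: "nat \<Rightarrow> gw_idx \<Rightarrow> real" where
  "coef k i = (case i of IX0 \<Rightarrow> gw_weight mxi meta k
     | IXm1 \<Rightarrow> (if k = 0 then 1 else meta * gw_weight mxi meta (k - 1))
     | Ieps n \<Rightarrow> gw_weight mxi meta (k - n) | _ \<Rightarrow> 0)"

definition L :: "nat \<Rightarrow> 'a \<Rightarrow> real" where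
  "L k \<omega> = (\<Sum>i\<in>sources k. coef k i * real (V i \<omega>))"

lemma sum_sources:
  "(\<Sum>i\<in>sources k. f i) = f IX0 + f IXm1 + (\<Sum>n=1..<k. f (Ieps n))"
proof -
  have "(\<Sum>i\<in>sources k. f i) = (\<Sum>i\<in>{IX0, IXm1}. f i) + (\<Sum>i\<in>Ieps ` {1..<k}. f i)"
    unfolding sources_def by (intro sum.union_disjoint) auto
  also have "(\<Sum>i\<in>Ieps ` {1..<k}. f i) = (\<Sum>n=1..<k. f (Ieps n))"
    by (subst sum.reindex) (auto simp: inj_on_def)
  finally show ?thesis by simp
qed

lemma mean_nonneg: "mxi \<ge> 0" "meta \<ge> 0"
  by (simp_all add: mxi_def meta_def)

lemma coef_nonneg: "coef k i \<ge> 0"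
  by (auto simp: coef_def gw_weight_nonneg mean_nonneg split: gw_idx.splits)

lemma L_nonneg: "L k \<omega> \<ge> 0"
  unfolding L_def by (intro sum_nonneg mult_nonneg_nonneg coef_nonneg) auto

lemma V_measurable: "i \<in> gw_idxs \<Longrightarrow> V i \<in> measurable M (count_space UNIV)"
  using indep by (auto simp: indep_vars_def)

lemma sources_subset: "sources k \<subseteq> gw_idxs"
  by (auto simp: sources_def gw_idxs_def)

lemma L_measurable [measurable]: "L k \<in> borel_measurable M"
  unfolding L_def
  by (intro borel_measurable_sum borel_measurable_times borel_measurable_const
        measurable_compose[OF V_measurable]) (use sources_subset in auto)

lemma U_eq: "k \<le> l \<Longrightarrow> U k \<omega> = gw_gen k (restrict (\<lambda>i. V i \<omega>) (gw_past l))"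
  by (simp add: U_def gw_gen_restrict)

lemma U_measurable [measurable]: "U k \<in> measurable M (count_space UNIV)"
proof -
  have "(\<lambda>\<omega>. restrict (\<lambda>i. V i \<omega>) (gw_past k)) \<in> measurable M (PiM (gw_past k) (\<lambda>_. count_space UNIV))"
    using gw_past_subset by (intro measurable_restrict V_measurable) auto
  from measurable_compose[OF this measurable_gw_gen[OF order.refl]]
  show ?thesis by (simp add: U_eq[OF order.refl, abs_def])
qed

lemma L_rec: "L (Suc (Suc k)) \<omega> = mxi * L (Suc k) \<omega> + meta * L k \<omega> + real (V (Ieps (Suc k)) \<omega>)"
proof -
  let ?w = "gw_weight mxi meta" and ?e = "\<lambda>n. real (V (Ieps n) \<omega>)"
  have "(\<Sum>n=1..<Suc (Suc k). ?w (Suc (Suc k) - n) * ?e n) =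
        (\<Sum>n=1..<Suc k. ?w (Suc (Suc k) - n) * ?e n) + ?e (Suc k)" by simp
  also have "(\<Sum>n=1..<Suc k. ?w (Suc (Suc k) - n) * ?e n) =
     (\<Sum>n=1..<Suc k. mxi * (?w (Suc k - n) * ?e n) + meta * (?w (k - n) * ?e n))"
    by (intro sum.cong) (auto simp: Suc_diff_le algebra_simps)
  also have "\<dots> = mxi * (\<Sum>n=1..<Suc k. ?w (Suc k - n) * ?e n) + meta * (\<Sum>n=1..<Suc k. ?w (k - n) * ?e n)"
    by (simp only: sum.distrib sum_distrib_left)
  \<comment> \<open>The extra term n = k carries \<open>gw_weight\<close> at 0, which is 0.\<close>
  also have "(\<Sum>n=1..<Suc k. ?w (k - n) * ?e n) = (\<Sum>n=1..<k. ?w (k - n) * ?e n)"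
    by (cases k) auto
  finally have eps: "(\<Sum>n=1..<Suc (Suc k). ?w (Suc (Suc k) - n) * ?e n) =
      mxi * (\<Sum>n=1..<Suc k. ?w (Suc k - n) * ?e n) + meta * (\<Sum>n=1..<k. ?w (k - n) * ?e n) + ?e (Suc k)" .
  have Xm1: "coef (Suc (Suc k)) IXm1 = mxi * coef (Suc k) IXm1 + meta * coef k IXm1"
    by (cases k) (auto simp: coef_def algebra_simps)
  have X0: "coef (Suc (Suc k)) IX0 = mxi * coef (Suc k) IX0 + meta * coef k IX0"
    by (auto simp: coef_def)
  have ceps: "coef j (Ieps n) = ?w (j - n)" for j n by (simp add: coef_def)
  show ?thesis unfolding L_def sum_sources ceps eps X0 Xm1 by (simp only: algebra_simps)
qed

lemma tail_eps:
  assumes "n \<ge> 1"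
  shows "tail M (\<lambda>\<omega>. real (V (Ieps n) \<omega>)) = tail M (\<lambda>\<omega>. real (V (Ieps 1) \<omega>))"
proof
  fix x
  have *: "tail M (\<lambda>\<omega>. real (V (Ieps m) \<omega>)) x = measure (distr M (count_space UNIV) (V (Ieps m))) {k. real k > x}"
    if "m \<ge> 1" for m
    unfolding tail_def using that
    by (subst measure_distr[OF V_measurable]) (auto simp: gw_idxs_def intro!: arg_cong[where f = prob])
  show "tail M (\<lambda>\<omega>. real (V (Ieps n) \<omega>)) x = tail M (\<lambda>\<omega>. real (V (Ieps 1) \<omega>)) x"
    unfolding *[OF assms] *[OF order.refl] eps_id[OF assms] ..
qed

lemma rv_source:
  assumes "i \<in> sources k"
  shows "rv (tail M (\<lambda>\<omega>. real (V i \<omega>))) \<beta>"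
proof -
  consider "i = IX0" | "i = IXm1" | n where "i = Ieps n" "n \<ge> 1"
    using assms by (auto simp: sources_def)
  thus ?thesis
  proof cases
    case 3
    show ?thesis unfolding 3(1) tail_eps[OF 3(2)] by (rule rv_eps1)
  qed (auto simp: rv_X0 rv_Xm1)
qed


lemma tail_L:
  "tail M (L k) \<sim>[at_top] (\<lambda>x. \<Sum>i\<in>sources k. coef k i powr \<beta> * tail M (\<lambda>\<omega>. real (V i \<omega>)) x)"
  and rv_L: "rv (tail M (L k)) \<beta>"
proof -
  have fin: "finite (sources k)" by (simp add: sources_def)
  \<comment> \<open>Other weights may vanish, but the latest immigration always has weight 1, as
    have the initial values at k = 0 and k = 1.\<close>
  have pos: "\<exists>i\<in>sources k. coef k i > 0"
  proof -
    consider "k = 0" | "k = 1" | "k \<ge> 2" by linarith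
    thus ?thesis
    proof cases
      case 1
      thus ?thesis by (intro bexI[of _ IXm1]) (auto simp: coef_def sources_def)
    next
      case 2
      thus ?thesis by (intro bexI[of _ IX0]) (auto simp: coef_def sources_def)
    next
      case 3
      thus ?thesis by (intro bexI[of _ "Ieps (k - 1)"]) (auto simp: coef_def sources_def)
    qed
  qed
  have ind: "indep_vars (\<lambda>_. borel) (\<lambda>i \<omega>. real (V i \<omega>)) (sources k)"
    by (rule indep_vars_compose2[OF indep_vars_subset[OF indep sources_subset]]) simp
  note * = tail_linear_combination_asymp[OF fin pos ind rv_source _ coef_nonneg]
  show "tail M (L k) \<sim>[at_top] (\<lambda>x. \<Sum>i\<in>sources k. coef k i powr \<beta> * tail M (\<lambda>\<omega>. real (V i \<omega>)) x)"
    unfolding L_def[abs_def] by (rule *(1)) auto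
  show "rv (tail M (L k)) \<beta>"
    unfolding L_def[abs_def] by (rule *(2)) auto
qed

text \<open>\<open>k \<le> Suc l\<close> makes \<open>U k\<close> a function of
  \<open>gw_past (Suc l)\<close>, a block that omits the offspring with first index
  \<open>Suc l\<close>. Parametrising by the constructor \<open>Ix\<close> treats both kinds of
  offspring at once, with k = Suc l for \<open>Ixi\<close> and k = l for
  \<open>Ieta\<close>.\<close>

lemma offspring_deviation:
  assumes k: "k \<le> Suc l" and Ix: "Ix = Ixi \<or> Ix = Ieta"
    and m: "m = expectation (\<lambda>\<omega>. real (V (Ix 1 1) \<omega>))"
    and dev: "\<And>\<delta>. \<delta> > 0 \<Longrightarrow> (\<lambda>x. prob {\<omega>\<in>space M. \<bar>real (U k \<omega>) - L k \<omega>\<bar> > \<delta> * (x + L k \<omega>)}) \<in> o(tail M (L k))"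
    and le: "\<And>\<omega>. \<omega> \<in> space M \<Longrightarrow> m * L k \<omega> \<le> L l' \<omega>" and \<delta>: "\<delta> > 0"
  shows "(\<lambda>x. prob {\<omega>\<in>space M. \<bar>real (\<Sum>i=1..U k \<omega>. V (Ix (Suc l) i) \<omega>) - m * L k \<omega>\<bar> > \<delta> * (m * (x + L k \<omega>))})
     \<in> o(tail M (L l'))"
proof -
  define H where "H i \<omega> = (if i = 0 then U k \<omega> else V (Ix (Suc l) i) \<omega>)" for i \<omega>
  have "indep_vars (\<lambda>_. count_space UNIV) (\<lambda>i \<omega>. if i = 0 then gw_gen k (restrict (\<lambda>j. V j \<omega>) (gw_past (Suc l)))
          else V (Ix (Suc l) i) \<omega>) (UNIV :: nat set)"
  proof (rule indep_vars_function_Cons[OF indep gw_past_subset _ _ measurable_gw_gen[OF k]])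
    show "inj_on (Ix (Suc l)) {1..}" using Ix by (auto simp: inj_on_def)
    show "Ix (Suc l) i \<in> gw_idxs - gw_past (Suc l)" if "i \<ge> 1" for i
      using Ix that by (auto simp: gw_idxs_def gw_past_def)
  qed
  hence indH: "indep_vars (\<lambda>_. count_space UNIV) H UNIV"
    by (simp only: H_def[abs_def] U_eq[OF k])
  have "(\<lambda>x. prob {\<omega>\<in>space M. \<bar>real (\<Sum>i=1..H 0 \<omega>. H i \<omega>) - m * L k \<omega>\<bar> > \<delta> * (m * (x + L k \<omega>))}) \<in> o(tail M (L l'))"
  proof (rule random_sum_linear_deviation[OF indH _ _ _ r m])
    show "V (Ix 1 1) \<in> measurable M (count_space UNIV)"
      using Ix by (intro V_measurable) (auto simp: gw_idxs_def)
    show "distr M (count_space UNIV) (H i) = distr M (count_space UNIV) (V (Ix 1 1))" if "i \<ge> 1" for i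
      using Ix xi_id[of "Suc l" i] eta_id[of "Suc l" i] that by (auto simp: H_def[abs_def])
    show "integrable M (\<lambda>\<omega>. real (V (Ix 1 1) \<omega>) powr r)" using Ix int_xi int_eta by auto
  qed (use rv_L L_nonneg dev le \<delta> in \<open>auto simp: H_def\<close>)
  moreover have "(\<Sum>i=1..H 0 \<omega>. H i \<omega>) = (\<Sum>i=1..U k \<omega>. V (Ix (Suc l) i) \<omega>)" for \<omega>
    by (auto simp: H_def intro!: sum.cong)
  ultimately show ?thesis by (simp only:)
qed

lemma L_le: "mxi * L (Suc k) \<omega> \<le> L (Suc (Suc k)) \<omega>" "meta * L k \<omega> \<le> L (Suc (Suc k)) \<omega>"
  using mult_nonneg_nonneg[OF mean_nonneg(1) L_nonneg[of "Suc k" \<omega>]]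
    mult_nonneg_nonneg[OF mean_nonneg(2) L_nonneg[of k \<omega>]] by (auto simp: L_rec)

lemma deviation_init:
  assumes "\<And>\<omega>. L k \<omega> = real (U k \<omega>)" "\<delta> > 0"
  shows "(\<lambda>x. prob {\<omega>\<in>space M. \<bar>real (U k \<omega>) - L k \<omega>\<bar> > \<delta> * (x + L k \<omega>)}) \<in> o(f)"
proof -
  have "\<forall>\<^sub>F x in at_top. prob {\<omega>\<in>space M. \<bar>real (U k \<omega>) - L k \<omega>\<bar> > \<delta> * (x + L k \<omega>)} = 0"
    using eventually_ge_at_top[of 0]
  proof eventually_elim
    case (elim x)
    have "{\<omega>\<in>space M. \<bar>real (U k \<omega>) - L k \<omega>\<bar> > \<delta> * (x + L k \<omega>)} = {}"
      using assms elim L_nonneg[of k] by (auto simp: not_less)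
    thus ?case by (simp only: measure_empty)
  qed
  from landau_o.small.in_cong[OF this] show ?thesis by simp
qed

lemma deviation:
  "\<delta> > 0 \<Longrightarrow> (\<lambda>x. prob {\<omega>\<in>space M. \<bar>real (U k \<omega>) - L k \<omega>\<bar> > \<delta> * (x + L k \<omega>)}) \<in> o(tail M (L k))"
proof (induction k arbitrary: \<delta> rule: induct_nat_012)
  case 0
  thus ?case by (intro deviation_init) (auto simp: L_def sum_sources coef_def U_def)
next
  case 1
  thus ?case by (intro deviation_init) (auto simp: L_def sum_sources coef_def U_def)
next
  case (ge2 k)
  \<comment> \<open>The two tolerances sum to at most \<epsilon> ((mxi + meta) x + L), with L the
    new combination; c exceeds both mxi + meta and 1, so dividing \<delta> by c suffices.\<close>
  define c where "c = 1 + mxi + meta"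
  define \<epsilon> where "\<epsilon> = \<delta> / c"
  have c: "c \<ge> 1" using mean_nonneg by (simp add: c_def)
  have \<epsilon>: "\<epsilon> > 0" "\<epsilon> * c = \<delta>" using ge2.prems c by (auto simp: \<epsilon>_def)
  let ?A = "\<lambda>x. {\<omega>\<in>space M. \<bar>real (\<Sum>i=1..U (Suc k) \<omega>. V (Ixi (Suc k) i) \<omega>) - mxi * L (Suc k) \<omega>\<bar>
       > \<epsilon> * (mxi * (x + L (Suc k) \<omega>))}"
  let ?B = "\<lambda>x. {\<omega>\<in>space M. \<bar>real (\<Sum>i=1..U k \<omega>. V (Ieta (Suc k) i) \<omega>) - meta * L k \<omega>\<bar>
       > \<epsilon> * (meta * (x + L k \<omega>))}"
  let ?R = "\<lambda>x. {\<omega>\<in>space M. \<bar>real (U (Suc (Suc k)) \<omega>) - L (Suc (Suc k)) \<omega>\<bar> > \<delta> * (x + L (Suc (Suc k)) \<omega>)}"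
  have "(\<lambda>x. prob (?A x)) \<in> o(tail M (L (Suc (Suc k))))"
    using ge2.IH(2) \<epsilon> L_le(1) by (intro offspring_deviation) (auto simp: mxi_def)
  moreover have "(\<lambda>x. prob (?B x)) \<in> o(tail M (L (Suc (Suc k))))"
    using ge2.IH(1) \<epsilon> L_le(2) by (intro offspring_deviation) (auto simp: meta_def)
  ultimately have AB: "(\<lambda>x. prob (?A x) + prob (?B x)) \<in> o(tail M (L (Suc (Suc k))))"
    by (rule sum_in_smallo)
  have sumA: "(\<lambda>\<omega>. \<Sum>i=1..U (Suc k) \<omega>. V (Ixi (Suc k) i) \<omega>) \<in> measurable M (count_space UNIV)"
    by (intro measurable_compose_countable[OF _ U_measurable, where f = "\<lambda>m \<omega>. \<Sum>i=1..m. V (Ixi (Suc k) i) \<omega>"]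
          measurable_sum_nat V_measurable) (auto simp: gw_idxs_def)
  have sumB: "(\<lambda>\<omega>. \<Sum>i=1..U k \<omega>. V (Ieta (Suc k) i) \<omega>) \<in> measurable M (count_space UNIV)"
    by (intro measurable_compose_countable[OF _ U_measurable, where f = "\<lambda>m \<omega>. \<Sum>i=1..m. V (Ieta (Suc k) i) \<omega>"]
          measurable_sum_nat V_measurable) (auto simp: gw_idxs_def)
  have sets: "{\<omega>\<in>space M. \<bar>real (Q \<omega>) - m * L j \<omega>\<bar> > \<epsilon> * (m * (x + L j \<omega>))} \<in> sets M"
    if [measurable]: "Q \<in> measurable M (count_space UNIV)" for Q :: "'a \<Rightarrow> nat" and m x j
    by measurable
  have setA: "?A x \<in> sets M" and setB: "?B x \<in> sets M" for x
    by (rule sets[OF sumA], rule sets[OF sumB])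
  have "(\<lambda>x. prob (?R x)) \<in> O(\<lambda>x. prob (?A x) + prob (?B x))"
  proof (rule bigoI[of _ 1])
    show "\<forall>\<^sub>F x in at_top. norm (prob (?R x)) \<le> 1 * norm (prob (?A x) + prob (?B x))"
      using eventually_ge_at_top[of 0]
    proof eventually_elim
      case (elim x)
      have "prob (?R x) \<le> prob (?A x \<union> ?B x)"
      proof (intro finite_measure_mono subsetI sets.Un setA setB)
        fix \<omega> assume "\<omega> \<in> ?R x"
        hence \<omega>: "\<omega> \<in> space M"
          and R: "\<bar>real (U (Suc (Suc k)) \<omega>) - L (Suc (Suc k)) \<omega>\<bar> > \<delta> * (x + L (Suc (Suc k)) \<omega>)" by auto
        define a where "a = real (\<Sum>i=1..U (Suc k) \<omega>. V (Ixi (Suc k) i) \<omega>)"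
        define b where "b = real (\<Sum>i=1..U k \<omega>. V (Ieta (Suc k) i) \<omega>)"
        show "\<omega> \<in> ?A x \<union> ?B x"
        proof (rule ccontr)
          assume "\<omega> \<notin> ?A x \<union> ?B x"
          hence A: "\<bar>a - mxi * L (Suc k) \<omega>\<bar> \<le> \<epsilon> * (mxi * (x + L (Suc k) \<omega>))"
            and B: "\<bar>b - meta * L k \<omega>\<bar> \<le> \<epsilon> * (meta * (x + L k \<omega>))"
            using \<omega> by (auto simp: a_def b_def)
          \<comment> \<open>The immigration enters the process and its linearisation identically and
            cancels.\<close>
          have "real (U (Suc (Suc k)) \<omega>) = a + b + real (V (Ieps (Suc k)) \<omega>)"
            by (simp add: U_def a_def b_def)
          hence "\<bar>real (U (Suc (Suc k)) \<omega>) - L (Suc (Suc k)) \<omega>\<bar>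
             = \<bar>(a - mxi * L (Suc k) \<omega>) + (b - meta * L k \<omega>)\<bar>" by (simp add: L_rec algebra_simps)
          also have "\<dots> \<le> \<bar>a - mxi * L (Suc k) \<omega>\<bar> + \<bar>b - meta * L k \<omega>\<bar>" by (rule abs_triangle_ineq)
          also have "\<dots> \<le> \<epsilon> * (mxi * (x + L (Suc k) \<omega>)) + \<epsilon> * (meta * (x + L k \<omega>))"
            by (intro add_mono A B)
          also have "\<dots> = \<epsilon> * ((mxi + meta) * x + (mxi * L (Suc k) \<omega> + meta * L k \<omega>))"
            by (simp add: algebra_simps)
          also have "\<dots> \<le> \<epsilon> * (c * x + c * L (Suc (Suc k)) \<omega>)"
          proof (intro mult_left_mono add_mono)
            show "(mxi + meta) * x \<le> c * x" using elim by (intro mult_right_mono) (auto simp: c_def)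
            have "mxi * L (Suc k) \<omega> + meta * L k \<omega> \<le> 1 * L (Suc (Suc k)) \<omega>" by (simp add: L_rec)
            also have "\<dots> \<le> c * L (Suc (Suc k)) \<omega>" using c L_nonneg by (intro mult_right_mono) auto
            finally show "mxi * L (Suc k) \<omega> + meta * L k \<omega> \<le> c * L (Suc (Suc k)) \<omega>" .
          qed (use \<epsilon> in auto)
          also have "\<dots> = \<delta> * (x + L (Suc (Suc k)) \<omega>)" by (simp add: algebra_simps flip: \<epsilon>(2))
          finally show False using R by simp
        qed
      qed
      also have "\<dots> \<le> prob (?A x) + prob (?B x)" by (intro measure_Un_le setA setB)
      finally show ?case by simp
    qed
  qed
  from landau_o.big_small_trans[OF this AB] show ?case .
qed

lemma tail_U: "tail M (\<lambda>\<omega>. real (U k \<omega>)) \<sim>[at_top] tail M (L k)"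
  using deviation by (intro relative_deviation_asymp[OF _ _ rv_L]) auto

end

section \<open>Transfer to the process indexed from -1\<close>

theorem theorem3p10:
  fixes M :: "'a measure"
    and X :: "int \<Rightarrow> 'a \<Rightarrow> nat"
    and xi eta :: "nat \<Rightarrow> nat \<Rightarrow> 'a \<Rightarrow> nat"
    and eps :: "nat \<Rightarrow> 'a \<Rightarrow> nat"
    and \<beta> r :: real and n :: nat
  assumes "prob_space M"
    and indep: "prob_space.indep_vars M (\<lambda>_. count_space UNIV)
                  (gw_var (X 0) (X (-1)) xi eta eps) gw_idxs"
    and rec: "\<And>k \<omega>. k \<ge> 1 \<Longrightarrow> \<omega> \<in> space M \<Longrightarrow>
           X (int k) \<omega> = (\<Sum>i\<in>{1..X (int k - 1) \<omega>}. xi k i \<omega>)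
                        + (\<Sum>j\<in>{1..X (int k - 2) \<omega>}. eta k j \<omega>) + eps k \<omega>"
    and xi_id: "\<And>k i. k \<ge> 1 \<Longrightarrow> i \<ge> 1 \<Longrightarrow>
           distr M (count_space UNIV) (xi k i) = distr M (count_space UNIV) (xi 1 1)"
    and eta_id: "\<And>k j. k \<ge> 1 \<Longrightarrow> j \<ge> 1 \<Longrightarrow>
           distr M (count_space UNIV) (eta k j) = distr M (count_space UNIV) (eta 1 1)"
    and eps_id: "\<And>k. k \<ge> 1 \<Longrightarrow>
           distr M (count_space UNIV) (eps k) = distr M (count_space UNIV) (eps 1)"
    and "\<beta> \<ge> 0"
    and rv0: "regvar M (\<lambda>\<omega>. real (X 0 \<omega>)) \<beta>"
    and rvm1: "regvar M (\<lambda>\<omega>. real (X (-1) \<omega>)) \<beta>"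
    and rveps: "regvar M (\<lambda>\<omega>. real (eps 1 \<omega>)) \<beta>"
    and "r > max 1 \<beta>"
    and "integrable M (\<lambda>\<omega>. real (xi 1 1 \<omega>) powr r)"
    and "integrable M (\<lambda>\<omega>. real (eta 1 1 \<omega>) powr r)"
    and "n \<ge> 1"
  shows "(\<lambda>x::real. measure M {\<omega>\<in>space M. real (X (int n) \<omega>) > x}) \<sim>[at_top]
           (\<lambda>x. (let mxi = integral\<^sup>L M (\<lambda>\<omega>. real (xi 1 1 \<omega>));
                     meta = integral\<^sup>L M (\<lambda>\<omega>. real (eta 1 1 \<omega>))
                 in mseq mxi meta n powr \<beta> * measure M {\<omega>\<in>space M. real (X 0 \<omega>) > x}
                    + mseq mxi meta (n - 1) powr \<beta> * meta powr \<beta>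
                        * measure M {\<omega>\<in>space M. real (X (-1) \<omega>) > x}
                    + (\<Sum>i=1..n. mseq mxi meta (n - i) powr \<beta>)
                        * measure M {\<omega>\<in>space M. real (eps 1 \<omega>) > x}))
       \<and> regvar M (\<lambda>\<omega>. real (X (int n) \<omega>)) \<beta>"
proof -
  interpret prob_space M by fact
  define V where "V = gw_var (X 0) (X (-1)) xi eta eps"
  have V: "V IX0 = X 0" "V IXm1 = X (-1)" "V (Ixi k i) = xi k i" "V (Ieta k i) = eta k i" "V (Ieps k) = eps k" for k i
    by (auto simp: V_def gw_var_def)
  interpret gw: second_order_gw M V \<beta> r
  proof unfold_locales
    show "indep_vars (\<lambda>_. count_space UNIV) V gw_idxs" using indep by (simp only: V_def)
    show "rv (tail M (\<lambda>\<omega>. real (V IX0 \<omega>))) \<beta>" "rv (tail M (\<lambda>\<omega>. real (V IXm1 \<omega>))) \<beta>"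
      "rv (tail M (\<lambda>\<omega>. real (V (Ieps 1) \<omega>))) \<beta>"
      using rv0 rvm1 rveps unfolding V regvar_iff_rv by simp_all
    show "r > 1" "r > \<beta>" using \<open>r > max 1 \<beta>\<close> by simp_all
    show "distr M (count_space UNIV) (V (Ixi k i)) = distr M (count_space UNIV) (V (Ixi 1 1))"
      if "k \<ge> 1" "i \<ge> 1" for k i unfolding V by (rule xi_id[OF that])
    show "distr M (count_space UNIV) (V (Ieta k i)) = distr M (count_space UNIV) (V (Ieta 1 1))"
      if "k \<ge> 1" "i \<ge> 1" for k i unfolding V by (rule eta_id[OF that])
    show "distr M (count_space UNIV) (V (Ieps k)) = distr M (count_space UNIV) (V (Ieps 1))"
      if "k \<ge> 1" for k unfolding V by (rule eps_id[OF that])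
    show "integrable M (\<lambda>\<omega>. real (V (Ixi 1 1) \<omega>) powr r)" unfolding V by fact
    show "integrable M (\<lambda>\<omega>. real (V (Ieta 1 1) \<omega>) powr r)" unfolding V by fact
  qed
  \<comment> \<open>The recursion is assumed only on \<open>space M\<close>, so the identification
    is pointwise there; the shift turns the integer indices from -1 on into natural numbers.\<close>
  have X_eq: "X (int k - 1) \<omega> = gw.U k \<omega>" if \<omega>: "\<omega> \<in> space M" for k \<omega>
  proof (induction k rule: induct_nat_012)
    case (ge2 k)
    have "X (int (Suc (Suc k)) - 1) \<omega> = X (int (Suc k)) \<omega>" by simp
    also have "\<dots> = (\<Sum>i=1..X (int (Suc k) - 1) \<omega>. xi (Suc k) i \<omega>)
        + (\<Sum>j=1..X (int k - 1) \<omega>. eta (Suc k) j \<omega>) + eps (Suc k) \<omega>"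
      using rec[of "Suc k" \<omega>] \<omega> by simp
    also have "\<dots> = gw.U (Suc (Suc k)) \<omega>"
      unfolding ge2.IH by (simp add: gw.U_def V)
    finally show ?case .
  qed (auto simp: gw.U_def V)
  have tail_X: "tail M (\<lambda>\<omega>. real (X (int n) \<omega>)) = tail M (\<lambda>\<omega>. real (gw.U (Suc n) \<omega>))"
    using X_eq[of _ "Suc n"] by (auto simp: tail_def fun_eq_iff intro!: arg_cong[where f = prob])
  have w: "mseq gw.mxi gw.meta k = gw_weight gw.mxi gw.meta (Suc k)" for k
    by (rule mseq_eq_gw_weight[OF gw.mean_nonneg])
  have "(\<Sum>i\<in>gw.sources (Suc n). gw.coef (Suc n) i powr \<beta> * tail M (\<lambda>\<omega>. real (V i \<omega>)) x) =
      mseq gw.mxi gw.meta n powr \<beta> * tail M (\<lambda>\<omega>. real (X 0 \<omega>)) x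
      + mseq gw.mxi gw.meta (n - 1) powr \<beta> * gw.meta powr \<beta> * tail M (\<lambda>\<omega>. real (X (-1) \<omega>)) x
      + (\<Sum>i=1..n. mseq gw.mxi gw.meta (n - i) powr \<beta>) * tail M (\<lambda>\<omega>. real (eps 1 \<omega>)) x" for x
  proof -
    have "(\<Sum>i=1..<Suc n. gw.coef (Suc n) (Ieps i) powr \<beta> * tail M (\<lambda>\<omega>. real (V (Ieps i) \<omega>)) x) =
       (\<Sum>i=1..n. mseq gw.mxi gw.meta (n - i) powr \<beta> * tail M (\<lambda>\<omega>. real (eps 1 \<omega>)) x)"
    proof (rule sum.cong)
      fix i assume "i \<in> {1..n}"
      hence i: "i \<ge> 1" and "Suc (n - i) = Suc n - i" by auto
      hence c: "gw.coef (Suc n) (Ieps i) = mseq gw.mxi gw.meta (n - i)"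
        by (simp add: gw.coef_def w del: gw_weight.simps)
      show "gw.coef (Suc n) (Ieps i) powr \<beta> * tail M (\<lambda>\<omega>. real (V (Ieps i) \<omega>)) x =
          mseq gw.mxi gw.meta (n - i) powr \<beta> * tail M (\<lambda>\<omega>. real (eps 1 \<omega>)) x"
        by (simp only: c gw.tail_eps[OF i]) (simp only: V)
    qed auto
    \<comment> \<open>The product rule persists for meta = 0 and \<beta> = 0: both sides are then 0
      because \<open>0 powr 0 = 0\<close>, in accordance with X_(-1) having no influence.\<close>
    moreover have "gw.coef (Suc n) IXm1 powr \<beta> = mseq gw.mxi gw.meta (n - 1) powr \<beta> * gw.meta powr \<beta>"
    proof -
      have "gw.coef (Suc n) IXm1 = mseq gw.mxi gw.meta (n - 1) * gw.meta"
        using \<open>n \<ge> 1\<close> unfolding w by (simp add: gw.coef_def del: gw_weight.simps)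
      thus ?thesis by (simp only: powr_mult)
    qed
    moreover have "gw.coef (Suc n) IX0 = mseq gw.mxi gw.meta n" unfolding w by (simp add: gw.coef_def)
    ultimately show ?thesis
      unfolding gw.sum_sources sum_distrib_right V(1,2) by (simp only:)
  qed
  hence "tail M (\<lambda>\<omega>. real (X (int n) \<omega>)) \<sim>[at_top] (\<lambda>x.
      mseq gw.mxi gw.meta n powr \<beta> * tail M (\<lambda>\<omega>. real (X 0 \<omega>)) x
      + mseq gw.mxi gw.meta (n - 1) powr \<beta> * gw.meta powr \<beta> * tail M (\<lambda>\<omega>. real (X (-1) \<omega>)) x
      + (\<Sum>i=1..n. mseq gw.mxi gw.meta (n - i) powr \<beta>) * tail M (\<lambda>\<omega>. real (eps 1 \<omega>)) x)"
    using asymp_equiv_trans[OF gw.tail_U gw.tail_L, of "Suc n"] by (simp only: tail_X)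
  moreover have "regvar M (\<lambda>\<omega>. real (X (int n) \<omega>)) \<beta>"
    unfolding regvar_iff_rv tail_X using \<open>\<beta> \<ge> 0\<close> rv_asymp_equiv[OF gw.rv_L gw.tail_U] by simp
  ultimately show ?thesis
    unfolding Let_def tail_def[abs_def] gw.mxi_def gw.meta_def V by (rule conjI)
qed

end
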